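(* Let $D\subsetneq\mathbb{C}^n$ be a proper convex domain. Then for all $z,w\in D$, $$l_D(z,w)\le\frac{\|z-w\|}{d_D(z)-d_D(w)}\log\frac{d_D(z)}{d_D(w)}\le\frac{\|z-w\|}{\min(d_D(z),d_D(w))},$$ where, if $d_D(z)=d_D(w)$, the statement is understood as $l_D(z,w)\le \|z-w\|/d_D(w)$. In particular, if, in addition, $D$ is bounded, then for any compact subset $K$ of $D$ there is a constant $c_K>0$ such that $$b_D(z,w)\le -c_K\log d_D(w)+1/c_K,\qquad z\in K,\ w\in D.$$
   Context: $\mathbb{D}$ is the open unit disc in $\mathbb{C}$; $\mathcal{O}(X,Y)$ is the set of holomorphic maps $X\to Y$; $\|\cdot\|$ is the Euclidean norm; $d_D(z)=\mathrm{dist}(z,\partial D)$ is the Euclidean distance to the boundary. A domain is a nonempty connected open set; proper means $D\neq\mathbb{C}^n$. The Lempert function of $D$ is $$l_D(z,w)=\inf\{\tanh^{-1}|\alpha|:\exists\varphi\in\mathcal{O}(\mathbb{D},D)\text{ with }\varphi(0)=z,\ \varphi(\alpha)=w\}.$$ The Bergman distance $b_D$ is $$b_D(z,w)=\inf_\gamma\int_0^1\beta_D(\gamma(t);\gamma'(t))\,dt,$$ where the infimum is over all smooth curves $\gamma:[0,1]\to D$ with $\gamma(0)=z$, $\gamma(1)=w$. Here $\beta_D(z;X)=M_D(z;X)/\sqrt{K_D(z)}$ is the Bergman metric, with $M_D(z;X)=\sup\{|f'(z)X|: f\in L^2_h(D),\ \|f\|_D=1,\ f(z)=0\}$ and $K_D(z)=\sup\{|f(z)|^2: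 f\in L^2_h(D),\ \|f\|_D\le 1\}$, where $L^2_h(D)$ is the space of square-integrable holomorphic functions on $D$ with its $L^2$ norm $\|\cdot\|_D$.
   Formalization: The last bound is proved as b_D(z,w) ≤ -c log d_D(w) + C with two independent positive constants c, C depending on K and D; with the single c_K and 1/c_K it fails for the unit disc and K = {|z| ≤ 0.9}. *)

theory Defs
  imports "HOL-Complex_Analysis.Complex_Analysis"
begin

text \<open>
  Points of n-dimensional complex space are elements of \<open>complex ^ 'n\<close>, whose \<^const>\<open>norm\<close> is the
  Euclidean one; \<open>c *s x\<close> is multiplication of a vector by a complex scalar.
\<close>

definition bdry_dist :: "(complex ^ 'n) set \<Rightarrow> complex ^ 'n \<Rightarrow> real" where
  "bdry_dist D z = infdist z (frontier D)"

definition hol_discs :: "(complex ^ 'n) set \<Rightarrow> (complex \<Rightarrow> complex ^ 'n) set" where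
  "hol_discs D = {\<phi>. (\<forall>i. (\<lambda>\<zeta>. \<phi> \<zeta> $ i) holomorphic_on ball 0 1) \<and> \<phi> ` ball 0 1 \<subseteq> D}"

text \<open>The infimum is taken in the extended reals, so that it is \<open>\<infinity>\<close> if there is no competitor.\<close>

definition lempert :: "(complex ^ 'n) set \<Rightarrow> complex ^ 'n \<Rightarrow> complex ^ 'n \<Rightarrow> ereal" where
  "lempert D z w =
     Inf {ereal (artanh (cmod \<alpha>)) | \<alpha> \<phi>. \<alpha> \<in> ball 0 1 \<and> \<phi> \<in> hol_discs D \<and> \<phi> 0 = z \<and> \<phi> \<alpha> = w}"

text \<open>
  Holomorphy in several variables on an open set: real Frechet differentiability with a
  complex-linear derivative.
\<close>

definition holomorphic_fun_on :: "(complex ^ 'n \<Rightarrow> complex) \<Rightarrow> (complex ^ 'n) set \<Rightarrow> bool" where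
  "holomorphic_fun_on f D \<longleftrightarrow>
     (\<forall>z\<in>D. \<exists>f'. (f has_derivative f') (at z) \<and> (\<forall>c X. f' (c *s X) = c * f' X))"

definition L2_hol :: "(complex ^ 'n) set \<Rightarrow> (complex ^ 'n \<Rightarrow> complex) set" where
  "L2_hol D =
     {f. holomorphic_fun_on f D \<and> set_integrable lborel D (\<lambda>x. (cmod (f x))\<^sup>2)}"

definition L2_norm_on :: "(complex ^ 'n) set \<Rightarrow> (complex ^ 'n \<Rightarrow> complex) \<Rightarrow> real" where
  "L2_norm_on D f = sqrt (LINT x:D|lborel. (cmod (f x))\<^sup>2)"

text \<open>
  The two suprema below are real-valued. For nonempty bounded open \<open>D\<close> and \<open>z \<in> D\<close> both are taken
  over nonempty sets that are bounded above.
\<close>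

definition bergman_K :: "(complex ^ 'n) set \<Rightarrow> complex ^ 'n \<Rightarrow> real" where
  "bergman_K D z = Sup {(cmod (f z))\<^sup>2 | f. f \<in> L2_hol D \<and> L2_norm_on D f \<le> 1}"

definition bergman_M :: "(complex ^ 'n) set \<Rightarrow> complex ^ 'n \<Rightarrow> complex ^ 'n \<Rightarrow> real" where
  "bergman_M D z X =
     Sup {cmod (frechet_derivative f (at z) X) | f. f \<in> L2_hol D \<and> L2_norm_on D f = 1 \<and> f z = 0}"

definition bergman_metric :: "(complex ^ 'n) set \<Rightarrow> complex ^ 'n \<Rightarrow> complex ^ 'n \<Rightarrow> real" where
  "bergman_metric D z X = bergman_M D z X / sqrt (bergman_K D z)"

abbreviation curve_deriv :: "(real \<Rightarrow> complex ^ 'n) \<Rightarrow> real \<Rightarrow> complex ^ 'n" where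
  "curve_deriv \<gamma> \<equiv> (\<lambda>t. vector_derivative \<gamma> (at t within {0..1}))"

text \<open>Smooth means infinitely differentiable, with one-sided derivatives at the end points.\<close>

definition smooth_curves ::
    "(complex ^ 'n) set \<Rightarrow> complex ^ 'n \<Rightarrow> complex ^ 'n \<Rightarrow> (real \<Rightarrow> complex ^ 'n) set" where
  "smooth_curves D z w =
     {\<gamma>. (\<forall>k. (curve_deriv ^^ k) \<gamma> differentiable_on {0..1}) \<and> \<gamma> ` {0..1} \<subseteq> D \<and> \<gamma> 0 = z \<and> \<gamma> 1 = w}"

definition bergman_dist :: "(complex ^ 'n) set \<Rightarrow> complex ^ 'n \<Rightarrow> complex ^ 'n \<Rightarrow> ereal" where
  "bergman_dist D z w =
     (INF \<gamma>\<in>smooth_curves D z w.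
        enn2ereal (\<integral>\<^sup>+t\<in>{0..1}. ennreal (bergman_metric D (\<gamma> t) (curve_deriv \<gamma> t)) \<partial>lborel))"

end

theory Submission
  imports Defs
begin

text \<open>
  Bounding \<open>l\<^sub>D\<close>: slice \<open>D\<close> by the complex line through \<open>z\<close> and \<open>w\<close>. By convexity the slice is a
  planar convex domain, which contains around each point of the segment a disc whose radius
  interpolates linearly between \<open>d\<^sub>D(z)\<close> and \<open>d\<^sub>D(w)\<close>. Its inverse Riemann map is a competitor for
  \<open>l\<^sub>D\<close>, and the Schwarz-Pick lemma bounds the hyperbolic length of the segment by the integral of
  the reciprocal radius. No triangle inequality for \<open>l\<^sub>D\<close> is needed.

  Bounding \<open>b\<^sub>D\<close>: contracting \<open>D\<close> by the factor \<open>1/2\<close> towards a point of \<open>D\<close> shows that \<open>K\<^sub>D\<close> at most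
  grows by a dimensional factor when \<open>z\<close> is replaced by a point at distance less than \<open>d\<^sub>D(z)/2\<close>.
  With the Cauchy estimate this bounds \<open>M\<^sub>D(z; X)\<close> by \<open>sqrt K\<^sub>D(z)\<close>, so that
  \<open>\<beta>\<^sub>D(z; X) \<le> C \<parallel>X\<parallel> / d\<^sub>D(z)\<close>; integrate along the segment.
\<close>

subsection \<open>Distance to the boundary of a convex domain\<close>

lemma norm_vector_scalar_mult: "norm (c *s x) = cmod c * norm (x :: complex ^ 'n)"
  by (simp add: norm_vec_def norm_mult L2_set_right_distrib)

lemma scaleR_eq_vector_scalar_mult: "a *\<^sub>R x = of_real a *s (x :: complex ^ 'n)"
  by (simp only: vec_eq_iff vector_scaleR_component vector_smult_component)
    (simp add: scaleR_conv_of_real)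

text \<open>The ball is connected and contains a point of \<open>D\<close>, so leaving
  \<open>D\<close> would force it to meet the frontier at a distance below the infimum.\<close>

lemma ball_bdry_dist_subset:
  fixes D :: "(complex ^ 'n) set"
  assumes "z \<in> D"
  shows "ball z (bdry_dist D z) \<subseteq> D"
proof (rule ccontr)
  assume not_sub: "\<not> ball z (bdry_dist D z) \<subseteq> D"
  then have "0 < bdry_dist D z"
    by (metis ball_eq_empty empty_subsetI not_le)
  then have "z \<in> ball z (bdry_dist D z) \<inter> D"
    using assms by simp
  with not_sub have "ball z (bdry_dist D z) \<inter> frontier D \<noteq> {}"
    by (intro connected_Int_frontier connected_ball) blast+
  then obtain y where "y \<in> frontier D" "dist z y < infdist z (frontier D)"
    by (auto simp: bdry_dist_def)
  then show False
    by (meson infdist_le not_le)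
qed

lemma frontier_nonempty:
  fixes D :: "'a::real_normed_vector set"
  assumes "D \<noteq> {}" "D \<noteq> UNIV"
  shows "frontier D \<noteq> {}"
  using assms frontier_eq_empty by blast

text \<open>Frontier points of an open set lie outside it, hence outside every ball it contains.
  Nonemptiness of the frontier matters because \<open>infdist\<close> to the empty set is 0.\<close>

lemma bdry_dist_ge:
  fixes D :: "(complex ^ 'n) set"
  assumes "open D" "frontier D \<noteq> {}" "ball z r \<subseteq> D"
  shows "r \<le> bdry_dist D z"
  unfolding bdry_dist_def infdist_notempty[OF assms(2)]
proof (rule cINF_greatest[OF assms(2)])
  fix y assume "y \<in> frontier D"
  then have "y \<notin> D"
    using assms(1) by (simp add: frontier_def interior_open)
  with assms(3) show "r \<le> dist z y"
    by (metis mem_ball not_le subsetD)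
qed

lemma bdry_dist_pos:
  fixes D :: "(complex ^ 'n) set"
  assumes "open D" "frontier D \<noteq> {}" "z \<in> D"
  shows "0 < bdry_dist D z"
  using bdry_dist_ge[OF assms(1,2)] assms(1,3) by (meson openE less_le_trans)

section \<open>Interpolating the radii of balls along a segment in a convex set\<close>

lemma interpolate_pos:
  fixes r s t :: real
  assumes "0 < r" "0 < s" "0 \<le> t" "t \<le> 1"
  shows "0 < (1 - t) * r + t * s"
  using convexD[OF convex_real_interval(3)[of 0], of r s "1 - t" t] assms by simp

text \<open>A vector \<open>v\<close> shorter than the interpolated radius \<open>\<rho>\<close> is
  the convex combination, with the same weights, of \<open>(r / \<rho>) v\<close> and
  \<open>(s / \<rho>) v\<close>, which fit into the two given balls.\<close>

lemma convex_ball_interpolate: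
  fixes D :: "'a::real_normed_vector set"
  assumes "convex D" "ball z r \<subseteq> D" "ball w s \<subseteq> D" "0 < r" "0 < s" "0 \<le> t" "t \<le> 1"
  shows "ball ((1 - t) *\<^sub>R z + t *\<^sub>R w) ((1 - t) * r + t * s) \<subseteq> D"
proof
  define \<rho> where "\<rho> = (1 - t) * r + t * s"
  have \<rho>: "0 < \<rho>"
    unfolding \<rho>_def using assms by (intro interpolate_pos)
  fix y assume "y \<in> ball ((1 - t) *\<^sub>R z + t *\<^sub>R w) ((1 - t) * r + t * s)"
  moreover define v where "v = y - ((1 - t) *\<^sub>R z + t *\<^sub>R w)"
  ultimately have v: "norm v < \<rho>"
    by (simp add: \<rho>_def dist_norm norm_minus_commute)
  have "z + (r / \<rho>) *\<^sub>R v \<in> D"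
    using v \<rho> assms(2,4) by (intro subsetD[OF assms(2)]) (simp add: dist_norm field_simps)
  moreover have "w + (s / \<rho>) *\<^sub>R v \<in> D"
    using v \<rho> assms(3,5) by (intro subsetD[OF assms(3)]) (simp add: dist_norm field_simps)
  ultimately have "(1 - t) *\<^sub>R (z + (r / \<rho>) *\<^sub>R v) + t *\<^sub>R (w + (s / \<rho>) *\<^sub>R v) \<in> D"
    using assms by (intro convexD) auto
  moreover have "(1 - t) *\<^sub>R (z + (r / \<rho>) *\<^sub>R v) + t *\<^sub>R (w + (s / \<rho>) *\<^sub>R v)
      = (1 - t) *\<^sub>R z + t *\<^sub>R w + (((1 - t) * r + t * s) / \<rho>) *\<^sub>R v"
    by (simp add: algebra_simps add_divide_distrib diff_divide_distrib)
  ultimately show "y \<in> D"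
    using \<rho> by (simp add: v_def flip: \<rho>_def)
qed

subsection \<open>The Lempert function\<close>

text \<open>Rescaling turns the ball into the unit disc and a Moebius map moves \<open>f a\<close>
  to 0, so that the Schwarz lemma applies at the origin. The derivative of the Moebius map at
  \<open>f a\<close> contributes the factor \<open>1 / (1 - |f a|^2)\<close>.\<close>

lemma Schwarz_Pick_deriv:
  assumes hol: "f holomorphic_on ball a r" and "0 < r" and bd: "f ` ball a r \<subseteq> ball 0 1"
  shows "cmod (deriv f a) * r \<le> 1 - (cmod (f a))\<^sup>2"
proof -
  define b where "b = f a"
  have b: "cmod b < 1"
    using bd \<open>0 < r\<close> by (auto simp: b_def image_subset_iff)
  then have b2: "(cmod b)\<^sup>2 < 1"
    by (simp add: power_less_one_iff abs_square_less_1)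
  then have nz: "1 - cnj b * b \<noteq> 0"
    by (metis complex_norm_square mult.commute of_real_1 of_real_eq_iff order_less_irrefl
        right_minus_eq of_real_power)
  define h where "h = Moebius_function 0 b \<circ> (\<lambda>\<zeta>. f (a + of_real r * \<zeta>))"
  have img: "a + of_real r * \<zeta> \<in> ball a r" if "\<zeta> \<in> ball 0 1" for \<zeta>
    using that \<open>0 < r\<close> by (simp add: dist_norm norm_mult)
  have "(f \<circ> (\<lambda>\<zeta>. a + of_real r * \<zeta>)) holomorphic_on ball 0 1"
    using img by (intro holomorphic_on_compose_gen[OF _ hol] holomorphic_intros) auto
  then have "h holomorphic_on ball 0 1"
    unfolding h_def o_def
    by (rule holomorphic_on_compose_gen[OF _ Moebius_function_holomorphic[OF b], unfolded o_def])
      (use bd img in blast)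
  moreover have "h 0 = 0"
    by (simp add: h_def Moebius_function_simple b_def)
  moreover have "norm (h \<zeta>) < 1" if "norm \<zeta> < 1" for \<zeta>
    unfolding h_def o_def
    by (rule Moebius_function_norm_lt_1[OF b]) (use bd img[of \<zeta>] that in force)
  ultimately have "cmod (deriv h 0) \<le> 1"
    by (intro Schwarz_Lemma(2)[of h 0]) auto
  moreover have "deriv h 0 = deriv f a * of_real r / (1 - cnj b * b)"
  proof (rule DERIV_imp_deriv)
    have "(f has_field_derivative deriv f a) (at (a + of_real r * 0))"
      using hol \<open>0 < r\<close> by (auto intro!: holomorphic_derivI[of f "ball a r"])
    then have 1: "((\<lambda>\<zeta>. f (a + of_real r * \<zeta>)) has_field_derivative deriv f a * of_real r) (at 0)"
      by (rule DERIV_chain2) (auto intro!: derivative_eq_intros)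
    show "(h has_field_derivative deriv f a * of_real r / (1 - cnj b * b)) (at 0)"
      unfolding h_def o_def Moebius_function_simple
      using nz by (auto intro!: derivative_eq_intros 1 simp: b_def)
  qed
  moreover have "cmod (1 - cnj b * b) = 1 - (cmod b)\<^sup>2"
  proof -
    have "1 - cnj b * b = of_real (1 - (cmod b)\<^sup>2)"
      by (simp add: complex_norm_square mult.commute del: of_real_power)
    then show ?thesis
      using b2 by (metis abs_of_pos diff_gt_0_iff_gt norm_of_real)
  qed
  ultimately show ?thesis
    using b2 \<open>0 < r\<close> by (simp only: norm_divide norm_mult) (simp add: b_def divide_le_eq)
qed

text \<open>On the unit disc, \<open>artanh\<close> of the modulus is the hyperbolic distance to 0.
  Schwarz-Pick on the ball of radius \<open>\<rho> t\<close> bounds the hyperbolic speed of the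
  image of the segment by \<open>1 / \<rho> t\<close>, so \<open>F - artanh u\<close> is
  nondecreasing, where \<open>u\<close> is a rotated real part of \<open>f\<close>.\<close>

lemma artanh_le_radius_integral:
  fixes f :: "complex \<Rightarrow> complex" and \<rho> F :: "real \<Rightarrow> real"
  assumes hol: "f holomorphic_on S" and "open S" and bd: "f ` S \<subseteq> ball 0 1" and f0: "f 0 = 0"
    and sub: "\<And>t. t \<in> {0..1} \<Longrightarrow> ball (of_real t) (\<rho> t) \<subseteq> S"
    and pos: "\<And>t. t \<in> {0..1} \<Longrightarrow> 0 < \<rho> t"
    and F: "\<And>t. t \<in> {0..1} \<Longrightarrow> (F has_real_derivative 1 / \<rho> t) (at t)"
  shows "artanh (cmod (f 1)) \<le> F 1 - F 0"
proof -
  \<comment> \<open>This rotation makes \<open>f 1\<close> real and nonnegative. The real part then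
    equals the modulus at 1, and unlike the modulus it is differentiable where \<open>f\<close>
    vanishes.\<close>
  obtain c where c: "cmod c = 1" "c * f 1 = of_real (cmod (f 1))"
  proof (cases "f 1 = 0")
    case False
    show ?thesis
    proof
      show "cmod (cnj (f 1) / of_real (cmod (f 1))) = 1"
        using False by (simp add: norm_divide)
      have "f 1 * cnj (f 1) = of_real (cmod (f 1)) * of_real (cmod (f 1))"
        by (metis complex_norm_square power2_eq_square of_real_power)
      then show "cnj (f 1) / of_real (cmod (f 1)) * f 1 = of_real (cmod (f 1))"
        using False by (simp add: mult.commute field_simps)
    qed
  qed (use that[of 1] in simp)
  define u where "u t = Re (c * f (of_real t))" for t
  have "\<exists>y. ((\<lambda>t. F t - artanh (u t)) has_real_derivative y) (at t) \<and> 0 \<le> y"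
    if t: "0 \<le> t" "t \<le> 1" for t
  proof -
    have tS: "of_real t \<in> S"
      using sub[of t] pos[of t] t by auto
    define p where "p = f (of_real t)"
    define d where "d = deriv f (of_real t)"
    have "(f has_field_derivative d) (at (of_real t))"
      unfolding d_def using hol \<open>open S\<close> tS by (rule holomorphic_derivI)
    then have "((\<lambda>t. f (of_real t)) has_vector_derivative d) (at t)"
      by (rule has_vector_derivative_real_field)
    then have "((\<lambda>t. c * f (of_real t)) has_vector_derivative c * d) (at t)"
      by (rule has_vector_derivative_mult_right)
    then have u': "(u has_real_derivative Re (c * d)) (at t)"
      unfolding u_def has_real_derivative_iff_has_vector_derivative
      by (rule bounded_linear.has_vector_derivative[OF bounded_linear_Re])
    have p1: "cmod p < 1"
      using bd tS by (auto simp: p_def image_subset_iff)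
    have ut: "\<bar>u t\<bar> \<le> cmod p"
      using abs_Re_le_cmod[of "c * p"] c by (simp add: u_def p_def norm_mult)
    then have u1: "\<bar>u t\<bar> < 1"
      using p1 by simp
    have u2: "(u t)\<^sup>2 \<le> (cmod p)\<^sup>2"
      using ut by (metis abs_le_square_iff abs_norm_cancel)
    have p2: "(cmod p)\<^sup>2 < 1"
      using p1 by (simp add: abs_square_less_1)
    have "Re (c * d) \<le> cmod d"
      using complex_Re_le_cmod[of "c * d"] c by (simp add: norm_mult)
    moreover have "cmod d * \<rho> t \<le> 1 - (cmod p)\<^sup>2"
      unfolding d_def p_def using sub[of t] pos[of t] t bd
      by (intro Schwarz_Pick_deriv holomorphic_on_subset[OF hol]) auto
    \<comment> \<open>Passing from the modulus to the real part loses nothing: the speed can only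
      drop, and \<open>1 - u^2\<close> can only grow because \<open>|u t|\<close> is at most
      \<open>|p|\<close>.\<close>
    ultimately have "Re (c * d) * \<rho> t \<le> 1 - (u t)\<^sup>2"
      using u2 pos[of t] t mult_right_mono[of "Re (c * d)" "cmod d" "\<rho> t"]
      by (smt (verit) atLeastAtMost_iff)
    then have "Re (c * d) / (1 - (u t)\<^sup>2) \<le> 1 / \<rho> t"
      using pos[of t] t u2 p2 by (simp add: field_simps)
    moreover have "((\<lambda>t. artanh (u t)) has_real_derivative 1 / (1 - (u t)\<^sup>2) * Re (c * d)) (at t)"
      using u1 by (intro DERIV_chain2[OF artanh_real_has_field_derivative u']) auto
    ultimately show ?thesis
      using DERIV_diff[OF F[of t]] t by (intro exI[of _ "1 / \<rho> t - 1 / (1 - (u t)\<^sup>2) * Re (c * d)"]) auto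
  qed
  then have "F 0 - artanh (u 0) \<le> F 1 - artanh (u 1)"
    by (intro DERIV_nonneg_imp_nondecreasing[of 0 1 "\<lambda>t. F t - artanh (u t)"]) auto
  then show ?thesis
    using c f0 by (simp add: u_def)
qed

section \<open>Competitors for the Lempert function on the slice by a complex line\<close>

lemma lempert_le_artanh:
  assumes "\<alpha> \<in> ball 0 1" "\<phi> \<in> hol_discs D" "\<phi> 0 = z" "\<phi> \<alpha> = w"
  shows "lempert D z w \<le> ereal (artanh (cmod \<alpha>))"
  unfolding lempert_def using assms by (intro Inf_lower) blast

lemma lempert_self_le:
  assumes "z \<in> D"
  shows "lempert D z z \<le> 0"
  using lempert_le_artanh[of 0 "\<lambda>_. z" D z z] assms
  by (auto simp: hol_discs_def zero_ereal_def)

text \<open>Any antiderivative \<open>F\<close> of the reciprocal interpolated radius may be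
  supplied, so the logarithmic case and the case of equal radii share one proof.\<close>

lemma lempert_le_radius_integral:
  fixes D :: "(complex ^ 'n) set" and F :: "real \<Rightarrow> real"
  assumes "open D" "convex D" "ball z r \<subseteq> D" "ball w s \<subseteq> D" "0 < r" "0 < s"
    and F: "\<And>t. t \<in> {0..1} \<Longrightarrow> (F has_real_derivative 1 / ((1 - t) * r + t * s)) (at t)"
  shows "lempert D z w \<le> ereal (norm (z - w) * (F 1 - F 0))"
proof (cases "z = w")
  case True
  have "z \<in> D"
    using assms(3,5) by auto
  with True show ?thesis
    using lempert_self_le[of z D] by (simp add: zero_ereal_def)
next
  case False
  define L where "L = norm (z - w)"
  have L: "0 < L"
    using False by (simp add: L_def)
  \<comment> \<open>The map \<open>line\<close> stretches distances by \<open>L\<close>, so dividing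
    by \<open>L\<close> expresses the radius in the parameter plane.\<close>
  define \<rho> where "\<rho> t = ((1 - t) * r + t * s) / L" for t
  have \<rho>: "0 < \<rho> t" if "t \<in> {0..1}" for t
  proof -
    have "0 < (1 - t) * r + t * s"
      using that assms(5,6) by (simp add: interpolate_pos)
    then show ?thesis
      using L by (simp add: \<rho>_def)
  qed
  define line where "line \<zeta> = z + \<zeta> *s (w - z)" for \<zeta> :: complex
  \<comment> \<open>The slice may be the whole plane, to which the Riemann mapping theorem does not
    apply. Cutting with a disc keeps it convex; \<open>R\<close> bounds \<open>|t|\<close> plus the
    largest possible \<open>\<rho> t\<close>, so all discs along the segment survive.\<close>
  define R where "R = 1 + (r + s) / L"
  define G where "G = line -` D \<inter> ball 0 R"
  have line_diff: "norm (line a - line b) = cmod (a - b) * L" for a b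
  proof -
    have "line a - line b = (a - b) *s (w - z)"
      by (simp add: line_def vec_eq_iff algebra_simps)
    then show ?thesis
      by (simp only: norm_vector_scalar_mult L_def norm_minus_commute[of w z])
  qed
  have cont: "continuous_on UNIV line"
  proof (rule continuous_onI)
    fix x e :: real and y assume "e > 0"
    fix a :: complex
    show "\<exists>d>0. \<forall>x'\<in>UNIV. dist x' a < d \<longrightarrow> dist (line x') (line a) \<le> e"
      using L \<open>e > 0\<close>
      by (intro exI[of _ "e / L"]) (auto simp: dist_norm line_diff field_simps)
  qed
  have "open G"
    unfolding G_def using assms(1) cont by (intro open_Int open_vimage) auto
  have line_comb: "line (u *\<^sub>R a + v *\<^sub>R b) = u *\<^sub>R line a + v *\<^sub>R line b" if "u + v = 1" for u v a b
  proof -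
    have "u = 1 - v" using that by simp
    then show ?thesis
      by (simp only: line_def vec_eq_iff vector_scaleR_component vector_smult_component
          vector_add_component vector_minus_component)
        (simp add: algebra_simps scaleR_conv_of_real)
  qed
  have "convex (line -` D)"
    using convexD[OF assms(2)] by (intro convexI) (auto simp: line_comb)
  then have "convex G"
    unfolding G_def by (intro convex_Int) auto
  have ball_G: "ball (of_real t) (\<rho> t) \<subseteq> G" if t: "t \<in> {0..1}" for t
  proof
    fix \<zeta> :: complex assume "\<zeta> \<in> ball (of_real t) (\<rho> t)"
    then have \<zeta>: "cmod (\<zeta> - of_real t) < \<rho> t"
      by (simp add: dist_norm norm_minus_commute)
    have "line (of_real t) = (1 - t) *\<^sub>R z + t *\<^sub>R w"
      by (simp only: line_def vec_eq_iff vector_scaleR_component vector_smult_component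
          vector_add_component vector_minus_component)
        (simp add: algebra_simps scaleR_conv_of_real)
    moreover have "norm (line \<zeta> - line (of_real t)) < (1 - t) * r + t * s"
      using \<zeta> L by (simp add: line_diff \<rho>_def field_simps)
    ultimately have "line \<zeta> \<in> D"
      using convex_ball_interpolate[OF assms(2-6), of t] t
      by (auto simp: dist_norm norm_minus_commute)
    moreover have "cmod \<zeta> < R"
    proof -
      have "cmod \<zeta> \<le> cmod (\<zeta> - of_real t) + \<bar>t\<bar>"
        by (metis diff_add_cancel norm_of_real norm_triangle_ineq)
      moreover have "\<rho> t \<le> (r + s) / L"
      proof -
        have "(1 - t) * r \<le> r" "t * s \<le> s"
          using assms(5,6) t by (auto simp: mult_left_le_one_le)
        then show ?thesis
          using L by (auto simp: \<rho>_def divide_right_mono)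
      qed
      ultimately show ?thesis
        using \<zeta> t by (simp add: R_def)
    qed
    ultimately show "\<zeta> \<in> G"
      by (simp add: G_def)
  qed
  have mem: "of_real t \<in> G" if "t \<in> {0..1}" for t
    using ball_G[OF that] \<rho>[OF that] by auto
  have G01: "0 \<in> G" "1 \<in> G"
    using mem[of 0] mem[of 1] by auto
  have "G \<noteq> UNIV"
    unfolding G_def by (metis bounded_Int bounded_ball not_bounded_UNIV)
  then obtain f g where fg: "f holomorphic_on G" "g holomorphic_on ball 0 1"
      "\<forall>x\<in>G. f x \<in> ball 0 1 \<and> g (f x) = x" "\<forall>x\<in>ball 0 1. g x \<in> G \<and> f (g x) = x"
    using Riemann_mapping_theorem[of G] \<open>open G\<close> convex_imp_simply_connected[OF \<open>convex G\<close>] G01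
    by (metis empty_iff)
  \<comment> \<open>The Riemann map need not fix 0. Moebius maps normalise it and its inverse to
    \<open>p\<close> and \<open>q\<close>, with \<open>p 0 = 0\<close>.\<close>
  define a where "a = f 0"
  have a: "cmod a < 1" "cmod (- a) < 1"
    using fg(3) G01(1) by (auto simp: a_def)
  define p where "p \<zeta> = Moebius_function 0 a (f \<zeta>)" for \<zeta>
  define q where "q \<zeta> = g (Moebius_function 0 (- a) \<zeta>)" for \<zeta>
  have p_hol: "p holomorphic_on G"
    unfolding p_def
    by (rule holomorphic_on_compose_gen[OF fg(1) Moebius_function_holomorphic[OF a(1)], unfolded o_def])
      (use fg(3) in blast)
  have q_hol: "q holomorphic_on ball 0 1"
    unfolding q_def
    by (rule holomorphic_on_compose_gen[OF Moebius_function_holomorphic[OF a(2)] fg(2), unfolded o_def])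
      (use Moebius_function_norm_lt_1[OF a(2)] in auto)
  have p_bd: "cmod (p \<zeta>) < 1" if "\<zeta> \<in> G" for \<zeta>
    unfolding p_def using Moebius_function_norm_lt_1[OF a(1)] fg(3) that by auto
  have q_img: "q \<zeta> \<in> G" if "cmod \<zeta> < 1" for \<zeta>
    unfolding q_def using Moebius_function_norm_lt_1[OF a(2) that] fg(4) by auto
  have qp: "q (p \<zeta>) = \<zeta>" if "\<zeta> \<in> G" for \<zeta>
    unfolding p_def q_def
    using Moebius_function_compose[of "- a" a "f \<zeta>"] a fg(3) that by auto
  have p0: "p 0 = 0"
    by (simp add: p_def a_def Moebius_function_eq_zero)
  have "artanh (cmod (p 1)) \<le> L * F 1 - L * F 0"
  proof (rule artanh_le_radius_integral[OF p_hol \<open>open G\<close> _ p0])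
    show "((\<lambda>t. L * F t) has_real_derivative 1 / \<rho> t) (at t)" if "t \<in> {0..1}" for t
      using DERIV_cmult[OF F[OF that], of L] by (simp add: \<rho>_def)
  qed (use ball_G \<rho> p_bd in auto)
  \<comment> \<open>The competitor is \<open>q\<close> followed by \<open>line\<close>, a disc in
    \<open>D\<close> that passes through \<open>z\<close> at 0 and through \<open>w\<close> at
    \<open>p 1\<close>.\<close>
  moreover have "lempert D z w \<le> ereal (artanh (cmod (p 1)))"
  proof (rule lempert_le_artanh)
    show "p 1 \<in> ball 0 1"
      using p_bd G01 by simp
    show "line (q 0) = z" "line (q (p 1)) = w"
      using qp[OF G01(1)] qp[OF G01(2)] p0 by (simp_all add: line_def)
    show "(\<lambda>\<zeta>. line (q \<zeta>)) \<in> hol_discs D"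
      using q_img by (auto simp: hol_discs_def line_def G_def intro!: holomorphic_intros q_hol)
  qed
  ultimately show ?thesis
    by (simp add: L_def algebra_simps order_trans)
qed

text \<open>The interpolated radius has slope \<open>s - r\<close>, which explains the minus sign.
  Equal radii need their own antiderivative, since division by \<open>r - s = 0\<close> yields
  0.\<close>

lemma DERIV_ln_interpolate:
  fixes r s :: real
  assumes "0 < r" "0 < s" "t \<in> {0..1}"
  shows "r \<noteq> s \<Longrightarrow> ((\<lambda>t. - ln ((1 - t) * r + t * s) / (r - s)) has_real_derivative
           1 / ((1 - t) * r + t * s)) (at t)"
    and "r = s \<Longrightarrow> ((\<lambda>t. t / s) has_real_derivative 1 / ((1 - t) * r + t * s)) (at t)"
proof -
  assume "r \<noteq> s"
  have "0 < (1 - t) * r + t * s"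
    using assms by (simp add: interpolate_pos)
  then show "((\<lambda>t. - ln ((1 - t) * r + t * s) / (r - s)) has_real_derivative
           1 / ((1 - t) * r + t * s)) (at t)"
  proof -
    define m where "m = (1 - t) * r + t * s"
    have "((\<lambda>t. (1 - t) * r + t * s) has_real_derivative s - r) (at t)"
      by (auto intro!: derivative_eq_intros)
    then have "((\<lambda>t. - ln ((1 - t) * r + t * s) / (r - s)) has_real_derivative
        - (1 / m * (s - r)) / (r - s)) (at t)"
      unfolding m_def using \<open>0 < (1 - t) * r + t * s\<close>
      by (intro DERIV_cdivide DERIV_minus DERIV_chain2[OF DERIV_ln_divide])
    moreover have "- (1 / m * (s - r)) = 1 / m * (r - s)"
      by (simp only: right_diff_distrib)
    then have "- (1 / m * (s - r)) / (r - s) = 1 / m"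
      using \<open>r \<noteq> s\<close> by (metis nonzero_mult_div_cancel_right right_minus_eq)
    ultimately show ?thesis
      by (simp only: m_def)
  qed
next
  assume "r = s"
  then show "((\<lambda>t. t / s) has_real_derivative 1 / ((1 - t) * r + t * s)) (at t)"
    using assms by (auto intro!: derivative_eq_intros simp: algebra_simps)
qed

text \<open>The inequality \<open>ln x \<le> x - 1\<close> at the quotient of the larger by the
  smaller number suffices, because the left-hand side is symmetric in \<open>r\<close> and
  \<open>s\<close>.\<close>

lemma ln_quotient_le_inverse_min:
  fixes r s :: real
  assumes "0 < r" "0 < s" "r \<noteq> s"
  shows "ln (r / s) / (r - s) \<le> 1 / min r s"
proof -
  have *: "ln (x / y) / (x - y) \<le> 1 / y" if "0 < y" "y < x" for x y :: real
  proof -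
    have "ln (x / y) \<le> x / y - 1"
      using that by (intro ln_le_minus_one) auto
    also have "\<dots> = (x - y) / y"
      using that by (simp add: field_simps)
    finally show ?thesis
      using that by (simp add: field_simps)
  qed
  show ?thesis
  proof (cases "s < r")
    case True
    then show ?thesis
      using *[of s r] assms by simp
  next
    case False
    have "ln (r / s) / (r - s) = ln (s / r) / (s - r)"
      using assms ln_div[of r s] ln_div[of s r] minus_divide_divide[of "ln (r / s)" "r - s"] by auto
    then show ?thesis
      using *[of r s] assms False by (simp add: min_def)
  qed
qed

subsection \<open>Invariance of Lebesgue measure under isometries\<close>

lemma emeasure_lborel_ball_pos:
  assumes "0 < r"
  shows "emeasure lborel (ball (x::'a::euclidean_space) r) > 0"
  using content_ball_pos[OF assms, of x]
  by (simp add: measure_def enn2real_positive_iff)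

lemma nn_integral_lborel_translate:
  fixes g :: "'a::euclidean_space \<Rightarrow> ennreal"
  assumes [measurable]: "g \<in> borel_measurable borel"
  shows "(\<integral>\<^sup>+x. g (c + x) \<partial>lborel) = (\<integral>\<^sup>+x. g x \<partial>lborel)"
  by (subst (2) lborel_distr_plus[symmetric, of c], subst nn_integral_distr) simp_all

lemma nn_integral_lborel_dilation:
  fixes g :: "'a::euclidean_space \<Rightarrow> ennreal"
  assumes [measurable]: "g \<in> borel_measurable borel" and "0 < a"
  shows "(\<integral>\<^sup>+x. g x \<partial>lborel) = ennreal (a ^ DIM('a)) * (\<integral>\<^sup>+x. g (c + a *\<^sub>R x) \<partial>lborel)"
  using \<open>0 < a\<close>
  by (subst lborel_affine[of a c]) (simp_all add: nn_integral_density nn_integral_distr nn_integral_cmult)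

text \<open>The image measure is translation invariant and agrees with Lebesgue measure on the unit
  ball \<open>B\<close>; evaluating the double integral of \<open>1\<^sub>A(x + y) 1\<^sub>B(y)\<close> in both orders then identifies
  the two measures.\<close>

lemma lborel_distr_linear_isometry:
  fixes f :: "'a::euclidean_space \<Rightarrow> 'a"
  assumes lin: "linear f" and iso: "\<And>x. norm (f x) = norm x"
  shows "distr lborel borel f = lborel"
proof (rule measure_eqI)
  interpret f: linear f by fact
  have cont: "continuous_on UNIV f"
    using lin by (simp add: linear_continuous_on linear_conv_bounded_linear)
  then have [measurable]: "f \<in> borel_measurable borel"
    by (rule borel_measurable_continuous_onI)
  have "inj f"
    using linear_injective_0[OF lin] iso by (metis norm_eq_zero)
  then have surj: "surj f"
    by (rule linear_injective_imp_surjective[OF lin]) simp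
  define \<mu> where "\<mu> = distr lborel borel f"
  have sets_mu [measurable_cong]: "sets \<mu> = sets borel"
    by (simp add: \<mu>_def)
  \<comment> \<open>By surjectivity a shift by \<open>c\<close> in the image comes from a shift by a
    preimage \<open>b\<close>, under which Lebesgue measure is invariant.\<close>
  have shift_mu: "(\<integral>\<^sup>+x. g (x + c) \<partial>\<mu>) = (\<integral>\<^sup>+x. g x \<partial>\<mu>)"
    if [measurable]: "g \<in> borel_measurable borel" for g :: "'a \<Rightarrow> ennreal" and c
  proof -
    obtain b where b: "c = f b"
      using surj by (metis surjD)
    have "(\<integral>\<^sup>+x. g (x + c) \<partial>\<mu>) = (\<integral>\<^sup>+x. g (f (b + x)) \<partial>lborel)"
      unfolding \<mu>_def by (subst nn_integral_distr) (simp_all add: b f.add add.commute)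
    also have "\<dots> = (\<integral>\<^sup>+x. g (f x) \<partial>lborel)"
      by (rule nn_integral_lborel_translate) measurable
    also have "\<dots> = (\<integral>\<^sup>+x. g x \<partial>\<mu>)"
      unfolding \<mu>_def by (subst nn_integral_distr) simp_all
    finally show ?thesis .
  qed
  define B where "B = ball (0::'a) 1"
  have [measurable]: "B \<in> sets borel"
    by (simp add: B_def)
  have minus_B: "- x \<in> B \<longleftrightarrow> x \<in> B" for x
    by (simp add: B_def)
  have B_vol: "emeasure lborel B \<noteq> 0" "emeasure lborel B \<noteq> \<infinity>"
    using emeasure_lborel_ball_pos[of 1 "0::'a"] emeasure_lborel_ball_finite[of "0::'a" 1]
    by (auto simp: B_def)
  have mu_B: "emeasure \<mu> B = emeasure lborel B"
    unfolding \<mu>_def by (subst emeasure_distr) (auto simp: B_def iso vimage_def ball_def)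
  \<comment> \<open>Fubini requires this. The isometry preserves norms, so centred balls have equal
    mass under both measures.\<close>
  have "sigma_finite_measure \<mu>"
  proof
    show "\<exists>A. countable A \<and> A \<subseteq> sets \<mu> \<and> \<Union> A = space \<mu> \<and> (\<forall>a\<in>A. emeasure \<mu> a \<noteq> \<infinity>)"
    proof (intro exI conjI ballI)
      show "\<Union> (range (\<lambda>n::nat. ball 0 (real n))) = space \<mu>"
        by (auto simp: \<mu>_def intro: reals_Archimedean2)
      fix a assume "a \<in> range (\<lambda>n::nat. ball (0::'a) (real n))"
      then obtain n where n: "a = ball 0 (real n)" by auto
      have "emeasure \<mu> a = emeasure lborel a"
        unfolding \<mu>_def by (subst emeasure_distr) (auto simp: n iso vimage_def ball_def)
      then show "emeasure \<mu> a \<noteq> \<infinity>"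
        using emeasure_lborel_ball_finite[of "0::'a" "real n"] by (simp add: n)
    qed (auto simp: \<mu>_def)
  qed
  then interpret pair_sigma_finite \<mu> lborel
    by (intro pair_sigma_finite.intro sigma_finite_lborel)
  fix A assume "A \<in> sets (distr lborel borel f)"
  then have [measurable]: "A \<in> sets borel"
    by simp
  have "emeasure \<mu> A * emeasure lborel B = (\<integral>\<^sup>+y. (\<integral>\<^sup>+x. indicator A (x + y) * indicator B y \<partial>\<mu>) \<partial>lborel)"
  proof -
    have "(\<integral>\<^sup>+x. indicator A (x + y) * indicator B y \<partial>\<mu>) = emeasure \<mu> A * indicator B y" for y
      using shift_mu[of "indicator A" y] by (simp add: nn_integral_multc sets_mu)
    then show ?thesis
      by (simp add: nn_integral_cmult)
  qed
  also have "\<dots> = (\<integral>\<^sup>+x. (\<integral>\<^sup>+y. indicator A (x + y) * indicator B y \<partial>lborel) \<partial>\<mu>)"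
    by (rule Fubini') measurable
  \<comment> \<open>The new variable is \<open>x + y\<close>; the symmetry of \<open>B\<close> under
    negation turns the second indicator into one of \<open>x - y\<close>, ready for a shift in
    \<open>x\<close>.\<close>
  also have "\<dots> = (\<integral>\<^sup>+x. (\<integral>\<^sup>+y. indicator A y * indicator B (x + - y) \<partial>lborel) \<partial>\<mu>)"
  proof (rule nn_integral_cong)
    fix x
    have "(\<integral>\<^sup>+y. indicator A (x + y) * indicator B y \<partial>lborel)
        = (\<integral>\<^sup>+y. indicator A (x + y) * indicator B (x + - (x + y)) \<partial>lborel)"
      using minus_B by (intro nn_integral_cong) (auto split: split_indicator)
    also have "\<dots> = (\<integral>\<^sup>+y. indicator A y * indicator B (x + - y) \<partial>lborel)"
      by (rule nn_integral_lborel_translate) measurable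
    finally show "(\<integral>\<^sup>+y. indicator A (x + y) * indicator B y \<partial>lborel)
        = (\<integral>\<^sup>+y. indicator A y * indicator B (x + - y) \<partial>lborel)" .
  qed
  also have "\<dots> = (\<integral>\<^sup>+y. (\<integral>\<^sup>+x. indicator A y * indicator B (x + - y) \<partial>\<mu>) \<partial>lborel)"
    by (rule Fubini'[symmetric]) measurable
  also have "\<dots> = emeasure lborel A * emeasure lborel B"
  proof -
    have "(\<integral>\<^sup>+x. indicator A y * indicator B (x + - y) \<partial>\<mu>) = indicator A y * emeasure \<mu> B" for y
      using shift_mu[of "indicator B" "- y"] by (simp add: nn_integral_cmult sets_mu)
    then show ?thesis
      by (simp add: nn_integral_multc mu_B)
  qed
  finally show "emeasure (distr lborel borel f) A = emeasure lborel A"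
    using B_vol by (simp add: \<mu>_def ennreal_mult_cancel_left mult.commute[of _ "emeasure lborel B"])
qed simp

text \<open>Serves for multiplication of vectors by unimodular scalars, over which holomorphic
  functions are averaged below.\<close>

lemma nn_integral_lborel_linear_isometry:
  fixes g :: "'a::euclidean_space \<Rightarrow> ennreal" and f :: "'a \<Rightarrow> 'a"
  assumes [measurable]: "g \<in> borel_measurable borel"
    and lin: "linear f" and iso: "\<And>x. norm (f x) = norm x"
  shows "(\<integral>\<^sup>+x. g (f x) \<partial>lborel) = (\<integral>\<^sup>+x. g x \<partial>lborel)"
proof -
  have [measurable]: "f \<in> borel_measurable borel"
    using lin by (intro borel_measurable_continuous_onI)
      (simp add: linear_continuous_on linear_conv_bounded_linear)
  show ?thesis
    by (subst (2) lborel_distr_linear_isometry[OF lin iso, symmetric], subst nn_integral_distr) simp_all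
qed

subsection \<open>Square-integrable holomorphic functions\<close>

text \<open>Cauchy's formula is applied to the holomorphic function \<open>g^2\<close> instead of
  \<open>g\<close>, so the triangle inequality for integrals gives the squared modulus
  directly.\<close>

lemma norm_square_le_circle_mean:
  assumes "g holomorphic_on cball 0 1"
  shows "ennreal ((cmod (g 0))\<^sup>2)
    \<le> (\<integral>\<^sup>+t\<in>{0..1}. ennreal ((cmod (g (exp (2 * of_real pi * \<i> * of_real t))))\<^sup>2) \<partial>lborel)"
proof -
  define e where "e t = exp (2 * of_real pi * \<i> * of_real t)" for t :: real
  have norm_e: "cmod (e t) = 1" for t
    by (simp add: e_def)
  have "(\<lambda>u. (g u)\<^sup>2) holomorphic_on cball 0 1"
    using assms by (intro holomorphic_intros)
  then have "((\<lambda>u. (g u)\<^sup>2 / (u - 0)) has_contour_integral (2 * of_real pi * \<i> * (g 0)\<^sup>2))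
      (circlepath 0 1)"
    by (intro Cauchy_integral_circlepath_simple) auto
  then have "((\<lambda>t. (g (e t))\<^sup>2 / e t * (2 * of_real pi * \<i> * e t))
      has_integral 2 * of_real pi * \<i> * (g 0)\<^sup>2) {0..1}"
    unfolding has_contour_integral_def
    by (rule has_integral_eq[rotated])
      (simp add: vector_derivative_circlepath01, simp add: circlepath e_def)
  then have "((\<lambda>t. 2 * of_real pi * \<i> * (g (e t))\<^sup>2) has_integral 2 * of_real pi * \<i> * (g 0)\<^sup>2) {0..1}"
    by (rule has_integral_eq[rotated]) (simp add: e_def)
  from has_integral_mult_right[OF this, of "1 / (2 * of_real pi * \<i>)"]
  have int: "((\<lambda>t. (g (e t))\<^sup>2) has_integral (g 0)\<^sup>2) {0..1}"
    by simp
  have "continuous_on {0..1} (\<lambda>t. g (e t))"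
    by (rule continuous_on_compose2[OF holomorphic_on_imp_continuous_on[OF assms]])
      (auto simp: norm_e intro!: continuous_intros simp: e_def)
  then have "continuous_on {0..1} (\<lambda>t. (cmod (g (e t)))\<^sup>2)"
    by (intro continuous_intros)
  then have "(\<lambda>t. (cmod (g (e t)))\<^sup>2) integrable_on {0..1}"
    by (rule integrable_continuous_real)
  then obtain I where I: "((\<lambda>t. (cmod (g (e t)))\<^sup>2) has_integral I) {0..1}"
    by blast
  have "norm ((g 0)\<^sup>2) \<le> I"
    using integral_norm_bound_integral[of "\<lambda>t. (g (e t))\<^sup>2" "{0..1}" "\<lambda>t. (cmod (g (e t)))\<^sup>2"] int I
    by (auto simp: norm_power integral_unique has_integral_integrable)
  moreover have "(\<integral>\<^sup>+t\<in>{0..1}. ennreal ((cmod (g (e t)))\<^sup>2) \<partial>lborel) = ennreal I"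
    by (rule nn_integral_has_integral_lebesgue'[OF _ I]) simp
  ultimately show ?thesis
    by (simp add: e_def norm_power ennreal_leI)
qed

section \<open>Restriction to complex lines and the sub-mean value property\<close>

lemma bounded_linear_scalar_mult_left: "bounded_linear (\<lambda>c. c *s (X :: complex ^ 'n))"
  unfolding linear_conv_bounded_linear[symmetric]
  by (rule linearI) (simp_all add: vec_eq_iff algebra_simps)

lemma linear_scalar_mult: "linear (\<lambda>X :: complex ^ 'n. c *s X)"
  by (rule linearI) (simp_all add: vec_eq_iff algebra_simps)

lemma continuous_on_scalar_mult [continuous_intros]:
  fixes f :: "'a::topological_space \<Rightarrow> complex" and g :: "'a \<Rightarrow> complex ^ 'n"
  assumes "continuous_on S f" "continuous_on S g"
  shows "continuous_on S (\<lambda>x. f x *s g x)"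
  unfolding vector_scalar_mult_def using assms by (intro continuous_intros)

text \<open>By the chain rule the derivative of the slice is \<open>h\<close> to
  \<open>f' (h *s X)\<close>, and complex linearity makes this multiplication by
  \<open>f' X\<close>.\<close>

lemma holomorphic_fun_on_slice:
  fixes f :: "complex ^ 'n \<Rightarrow> complex"
  assumes f': "(f has_derivative f') (at (z + \<zeta> *s X))" and lin: "\<And>c X. f' (c *s X) = c * f' X"
  shows "((\<lambda>\<zeta>. f (z + \<zeta> *s X)) has_field_derivative f' X) (at \<zeta>)"
proof -
  have "((\<lambda>\<zeta>. z + \<zeta> *s X) has_derivative (\<lambda>h. h *s X)) (at \<zeta>)"
    using has_derivative_add[OF has_derivative_const bounded_linear_imp_has_derivative[OF bounded_linear_scalar_mult_left]]
    by simp
  from has_derivative_compose[OF this f'] show ?thesis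
    by (simp add: has_field_derivative_def lin mult.commute[of _ "f' X"])
qed

lemma holomorphic_fun_on_slice_holomorphic:
  fixes f :: "complex ^ 'n \<Rightarrow> complex"
  assumes "holomorphic_fun_on f D" "open S" "\<And>\<zeta>. \<zeta> \<in> S \<Longrightarrow> z + \<zeta> *s X \<in> D"
  shows "(\<lambda>\<zeta>. f (z + \<zeta> *s X)) holomorphic_on S"
  unfolding holomorphic_on_open[OF assms(2)]
proof
  fix \<zeta> assume "\<zeta> \<in> S"
  then obtain f' where "(f has_derivative f') (at (z + \<zeta> *s X))" "\<And>c X. f' (c *s X) = c * f' X"
    using assms(1,3) unfolding holomorphic_fun_on_def by meson
  from holomorphic_fun_on_slice[OF this]
  show "\<exists>f'. ((\<lambda>\<zeta>. f (z + \<zeta> *s X)) has_field_derivative f') (at \<zeta>)" ..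
qed

lemma holomorphic_fun_on_imp_continuous_on:
  assumes "holomorphic_fun_on f D"
  shows "continuous_on D f"
proof (rule continuous_at_imp_continuous_on, rule ballI)
  fix z assume "z \<in> D"
  then show "isCont f z"
    using assms has_derivative_continuous unfolding holomorphic_fun_on_def by blast
qed

text \<open>For each \<open>v\<close> in the centred ball the value at \<open>z\<close> is bounded
  by the mean over the circle \<open>z + e t *s v\<close>. After integrating over \<open>v\<close>
  and exchanging integrals, rotation invariance of volume makes the inner integral independent of
  \<open>t\<close>; no polar coordinates enter.\<close>

lemma holomorphic_fun_on_norm_square_le:
  fixes f :: "complex ^ 'n \<Rightarrow> complex"
  assumes hol: "holomorphic_fun_on f D" and "open D" and sub: "ball z r \<subseteq> D"
  shows "ennreal ((cmod (f z))\<^sup>2) * emeasure lborel (ball (0 :: complex ^ 'n) r)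
    \<le> (\<integral>\<^sup>+x\<in>D. ennreal ((cmod (f x))\<^sup>2) \<partial>lborel)"
proof -
  \<comment> \<open>Extension by zero gives an integrand that is measurable on the whole
    space.\<close>
  define h where "h x = indicator D x *\<^sub>R (cmod (f x))\<^sup>2" for x
  define B where "B = ball (0 :: complex ^ 'n) r"
  define e where "e t = exp (2 * of_real pi * \<i> * of_real t)" for t :: real
  have norm_e: "cmod (e t) = 1" for t
    by (simp add: e_def)
  have [measurable]: "h \<in> borel_measurable borel"
    unfolding h_def using holomorphic_fun_on_imp_continuous_on[OF hol] \<open>open D\<close>
    by (intro borel_measurable_continuous_on_indicator continuous_intros) auto
  have [measurable]: "B \<in> sets borel"
    by (simp add: B_def)
  have "continuous_on UNIV (\<lambda>(t, v). z + e t *s (v :: complex ^ 'n))"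
    unfolding e_def case_prod_unfold by (intro continuous_intros)
  then have [measurable]: "(\<lambda>(t, v). z + e t *s v) \<in> borel_measurable (lborel \<Otimes>\<^sub>M lborel)"
    by (subst measurable_cong_sets[OF sets_pair_measure_cong[OF sets_lborel sets_lborel] refl])
      (simp add: borel_prod borel_measurable_continuous_onI)
  have mean: "ennreal ((cmod (f z))\<^sup>2) \<le> (\<integral>\<^sup>+t\<in>{0..1}. ennreal (h (z + e t *s v)) \<partial>lborel)"
    if v: "v \<in> B" for v
  proof -
    define S where "S = (\<lambda>\<zeta>. z + \<zeta> *s v) -` ball z r"
    have S_iff: "\<zeta> \<in> S \<longleftrightarrow> cmod \<zeta> * norm v < r" for \<zeta>
      by (simp add: S_def dist_norm norm_vector_scalar_mult)
    have "open S"
      unfolding S_def by (intro open_vimage continuous_intros) auto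
    then have "(\<lambda>\<zeta>. f (z + \<zeta> *s v)) holomorphic_on S"
      using sub by (intro holomorphic_fun_on_slice_holomorphic[OF hol]) (auto simp: S_def)
    moreover have S: "cball 0 1 \<subseteq> S"
    proof
      fix \<zeta> :: complex assume "\<zeta> \<in> cball 0 1"
      then have "cmod \<zeta> * norm v \<le> 1 * norm v"
        by (intro mult_right_mono) auto
      also have "\<dots> < r"
        using v by (simp add: B_def)
      finally show "\<zeta> \<in> S"
        by (simp add: S_iff)
    qed
    ultimately have "(\<lambda>\<zeta>. f (z + \<zeta> *s v)) holomorphic_on cball 0 1"
      by (rule holomorphic_on_subset)
    from norm_square_le_circle_mean[OF this]
    have "ennreal ((cmod (f z))\<^sup>2) \<le> (\<integral>\<^sup>+t\<in>{0..1}. ennreal ((cmod (f (z + e t *s v)))\<^sup>2) \<partial>lborel)"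
      by (simp add: e_def)
    also have "\<dots> = (\<integral>\<^sup>+t\<in>{0..1}. ennreal (h (z + e t *s v)) \<partial>lborel)"
    proof -
      have "z + e t *s v \<in> D" for t
      proof -
        have "e t \<in> S"
          using S norm_e[of t] by auto
        then show ?thesis
          using sub by (auto simp: S_def)
      qed
      then show ?thesis
        by (simp add: h_def)
    qed
    finally show ?thesis .
  qed
  have "ennreal ((cmod (f z))\<^sup>2) * emeasure lborel B
      = (\<integral>\<^sup>+v. ennreal ((cmod (f z))\<^sup>2) * indicator B v \<partial>lborel)"
    by (simp add: nn_integral_cmult_indicator)
  \<comment> \<open>The restriction to \<open>v\<close> in \<open>B\<close> is dropped here, so the
    inner domain becomes the whole space, invariant under rotations and translations.\<close>
  also have "\<dots> \<le> (\<integral>\<^sup>+v. (\<integral>\<^sup>+t. ennreal (h (z + e t *s v)) * indicator {0..1} t \<partial>lborel) \<partial>lborel)"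
    using mean by (intro nn_integral_mono) (auto split: split_indicator)
  also have "\<dots> = (\<integral>\<^sup>+t. (\<integral>\<^sup>+v. ennreal (h (z + e t *s v)) * indicator {0..1} t \<partial>lborel) \<partial>lborel)"
    by (rule lborel_pair.Fubini') measurable
  also have "\<dots> = (\<integral>\<^sup>+t. (\<integral>\<^sup>+x. ennreal (h x) \<partial>lborel) * indicator {0..1::real} t \<partial>lborel)"
  proof (rule nn_integral_cong)
    fix t :: real
    have "(\<integral>\<^sup>+v. ennreal (h (z + e t *s v)) \<partial>lborel) = (\<integral>\<^sup>+v. ennreal (h (z + v)) \<partial>lborel)"
      by (rule nn_integral_lborel_linear_isometry[OF _ linear_scalar_mult, where g = "\<lambda>v. ennreal (h (z + v))"])
        (measurable, simp add: norm_vector_scalar_mult norm_e)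
    also have "\<dots> = (\<integral>\<^sup>+x. ennreal (h x) \<partial>lborel)"
      by (rule nn_integral_lborel_translate[where g = "\<lambda>v. ennreal (h v)"]) measurable
    finally show "(\<integral>\<^sup>+v. ennreal (h (z + e t *s v)) * indicator {0..1} t \<partial>lborel)
        = (\<integral>\<^sup>+x. ennreal (h x) \<partial>lborel) * indicator {0..1} t"
      by (simp split: split_indicator)
  qed
  also have "\<dots> = (\<integral>\<^sup>+x. ennreal (h x) \<partial>lborel)"
    by (subst nn_integral_cmult) simp_all
  also have "\<dots> = (\<integral>\<^sup>+x\<in>D. ennreal ((cmod (f x))\<^sup>2) \<partial>lborel)"
    by (intro nn_integral_cong) (simp add: h_def split: split_indicator)
  finally show ?thesis
    by (simp add: B_def)
qed

section \<open>The L2 norm through nonnegative integrals, and bounds for the Bergman kernel\<close>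

lemma L2_norm_on_nonneg: "0 \<le> L2_norm_on D f"
  by (simp add: L2_norm_on_def set_lebesgue_integral_def)

lemma nn_integral_L2_hol:
  assumes "f \<in> L2_hol D"
  shows "(\<integral>\<^sup>+x\<in>D. ennreal ((cmod (f x))\<^sup>2) \<partial>lborel) = ennreal ((L2_norm_on D f)\<^sup>2)"
proof -
  have "(\<integral>\<^sup>+x\<in>D. ennreal ((cmod (f x))\<^sup>2) \<partial>lborel)
      = (\<integral>\<^sup>+x. ennreal (indicator D x *\<^sub>R (cmod (f x))\<^sup>2) \<partial>lborel)"
    by (intro nn_integral_cong) (simp split: split_indicator)
  also have "\<dots> = ennreal (LINT x:D|lborel. (cmod (f x))\<^sup>2)"
    using assms unfolding set_lebesgue_integral_def L2_hol_def set_integrable_def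
    by (intro nn_integral_eq_integral) auto
  finally show ?thesis
    by (simp add: L2_norm_on_def set_lebesgue_integral_def)
qed

text \<open>Continuity on the open set gives measurability, so finiteness of the nonnegative
  integral already yields integrability.\<close>

lemma L2_holI:
  assumes hol: "holomorphic_fun_on f D" and "open D"
    and le: "(\<integral>\<^sup>+x\<in>D. ennreal ((cmod (f x))\<^sup>2) \<partial>lborel) \<le> ennreal (c\<^sup>2)" and "0 \<le> c"
  shows "f \<in> L2_hol D" and "L2_norm_on D f \<le> c"
proof -
  have eq: "(\<integral>\<^sup>+x\<in>D. ennreal ((cmod (f x))\<^sup>2) \<partial>lborel)
      = (\<integral>\<^sup>+x. ennreal (indicator D x *\<^sub>R (cmod (f x))\<^sup>2) \<partial>lborel)"
    by (intro nn_integral_cong) (simp split: split_indicator)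
  have "(\<lambda>x. indicator D x *\<^sub>R (cmod (f x))\<^sup>2) \<in> borel_measurable borel"
    using holomorphic_fun_on_imp_continuous_on[OF hol] \<open>open D\<close>
    by (intro borel_measurable_continuous_on_indicator continuous_intros) auto
  then have "set_integrable lborel D (\<lambda>x. (cmod (f x))\<^sup>2)"
    unfolding set_integrable_def using le eq
    by (intro integrableI_nonneg) (auto simp: le_less_trans)
  with hol show mem: "f \<in> L2_hol D"
    by (simp add: L2_hol_def)
  have "(L2_norm_on D f)\<^sup>2 \<le> c\<^sup>2"
    using le nn_integral_L2_hol[OF mem] by simp
  then show "L2_norm_on D f \<le> c"
    using \<open>0 \<le> c\<close> by (rule power2_le_imp_le)
qed

text \<open>The sub-mean value property on a ball inside \<open>D\<close> bounds each competitor by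
  the reciprocal volume of that ball. This makes the real-valued supremum usable.\<close>

lemma bdd_above_bergman_K:
  fixes D :: "(complex ^ 'n) set"
  assumes "open D" "z \<in> D"
  shows "bdd_above {(cmod (f z))\<^sup>2 | f. f \<in> L2_hol D \<and> L2_norm_on D f \<le> 1}"
proof -
  obtain r where r: "0 < r" "ball z r \<subseteq> D"
    using assms openE by blast
  define V where "V = emeasure lborel (ball (0 :: complex ^ 'n) r)"
  have V: "V = ennreal (measure lborel (ball (0 :: complex ^ 'n) r))"
    unfolding V_def using emeasure_lborel_ball_finite[of "0 :: complex ^ 'n" r]
    by (intro emeasure_eq_ennreal_measure) auto
  have "(cmod (f z))\<^sup>2 \<le> 1 / measure lborel (ball (0 :: complex ^ 'n) r)"
    if f: "f \<in> L2_hol D" "L2_norm_on D f \<le> 1" for f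
  proof -
    have "ennreal ((cmod (f z))\<^sup>2) * V \<le> (\<integral>\<^sup>+x\<in>D. ennreal ((cmod (f x))\<^sup>2) \<partial>lborel)"
      unfolding V_def using f assms r by (intro holomorphic_fun_on_norm_square_le) (auto simp: L2_hol_def)
    also have "\<dots> \<le> ennreal 1"
      unfolding nn_integral_L2_hol[OF f(1)] using f(2) L2_norm_on_nonneg[of D f]
      by (intro ennreal_leI) (simp add: power_le_one)
    finally have "(cmod (f z))\<^sup>2 * measure lborel (ball (0 :: complex ^ 'n) r) \<le> 1"
      by (simp add: V ennreal_le_1 flip: ennreal_mult)
    then show ?thesis
      using content_ball_pos[OF r(1), of "0 :: complex ^ 'n"] by (simp add: pos_le_divide_eq)
  qed
  then show ?thesis
    by (intro bdd_aboveI) auto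
qed

lemma norm_square_le_bergman_K:
  assumes "open D" "z \<in> D" "f \<in> L2_hol D" "L2_norm_on D f \<le> 1"
  shows "(cmod (f z))\<^sup>2 \<le> bergman_K D z"
  unfolding bergman_K_def
  by (rule cSup_upper[OF _ bdd_above_bergman_K[OF assms(1,2)]]) (use assms in blast)

text \<open>The homothety \<open>x \<mapsto> x / 2 + (z + 2 Y) / 2\<close> maps the convex set \<open>D\<close> into itself and takes
  \<open>z\<close> to \<open>z + Y\<close>; composing competitors with it compares the Bergman kernels at the two points.\<close>

lemma bergman_K_Harnack:
  fixes D :: "(complex ^ 'n) set"
  assumes "open D" "convex D" "ball z r \<subseteq> D" "2 * norm Y < r" and f: "f \<in> L2_hol D" "L2_norm_on D f \<le> 1"
  shows "(cmod (f (z + Y)))\<^sup>2 \<le> 2 ^ DIM(complex ^ 'n) * bergman_K D z"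
proof -
  \<comment> \<open>\<open>N\<close> is the inverse Jacobian of the homothety, with exponent the
    real dimension. Dividing by its square root keeps the L2 norm of the composed function at most
    1.\<close>
  define N where "N = (2 :: real) ^ DIM(complex ^ 'n)"
  have N: "0 < N" "sqrt N > 0"
    by (simp_all add: N_def)
  have "0 \<le> norm Y"
    by simp
  with assms(4) have "0 < r"
    by linarith
  then have "z \<in> D"
    using assms(3) by auto
  define c where "c = (1/2) *\<^sub>R (z + 2 *\<^sub>R Y)"
  define T where "T x = c + (1/2) *\<^sub>R x" for x
  have "z + 2 *\<^sub>R Y \<in> D"
    using assms(4) by (intro subsetD[OF assms(3)]) (simp add: dist_norm)
  then have T_D: "T x \<in> D" if "x \<in> D" for x
    using convexD[OF assms(2) _ that, of _ "1/2" "1/2"] by (simp add: T_def c_def)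
  have T_z: "T z = z + Y"
    by (simp add: T_def c_def scaleR_right_distrib flip: scaleR_add_left)
  have T': "(T has_derivative (\<lambda>h. (1/2) *\<^sub>R h)) (at x)" for x
    unfolding T_def by (auto intro!: derivative_eq_intros)
  define h where "h x = indicator D x *\<^sub>R (cmod (f x))\<^sup>2" for x
  have hol: "holomorphic_fun_on f D"
    using f by (simp add: L2_hol_def)
  have [measurable]: "h \<in> borel_measurable borel"
    unfolding h_def using holomorphic_fun_on_imp_continuous_on[OF hol] \<open>open D\<close>
    by (intro borel_measurable_continuous_on_indicator continuous_intros) auto
  define g where "g x = f (T x) / of_real (sqrt N)" for x
  have "holomorphic_fun_on g D"
    unfolding holomorphic_fun_on_def
  proof
    fix x assume "x \<in> D"
    then obtain f' where f': "(f has_derivative f') (at (T x))" "\<And>c X. f' (c *s X) = c * f' X"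
      using hol T_D unfolding holomorphic_fun_on_def by meson
    have "(g has_derivative (\<lambda>h. f' ((1/2) *\<^sub>R h) / of_real (sqrt N))) (at x)"
      using has_derivative_compose[OF T' f'(1)] unfolding g_def
      by (rule bounded_linear.has_derivative[OF bounded_linear_divide])
    moreover have "f' ((1/2) *\<^sub>R (c *s X)) / of_real (sqrt N) = c * (f' ((1/2) *\<^sub>R X) / of_real (sqrt N))" for c X
      unfolding scaleR_eq_vector_scalar_mult by (simp add: f'(2))
    ultimately show "\<exists>f'. (g has_derivative f') (at x) \<and> (\<forall>c X. f' (c *s X) = c * f' X)"
      by blast
  qed
  moreover have "(\<integral>\<^sup>+x\<in>D. ennreal ((cmod (g x))\<^sup>2) \<partial>lborel) \<le> ennreal (1\<^sup>2)"
  proof -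
    have "(\<integral>\<^sup>+x\<in>D. ennreal ((cmod (g x))\<^sup>2) \<partial>lborel) \<le> (\<integral>\<^sup>+x. ennreal (1 / N) * ennreal (h (T x)) \<partial>lborel)"
      using T_D N
      by (intro nn_integral_mono)
        (auto simp: h_def g_def norm_divide power_divide simp flip: ennreal_mult split: split_indicator)
    also have "\<dots> = ennreal ((1/2) ^ DIM(complex ^ 'n)) * (\<integral>\<^sup>+x. ennreal (h (T x)) \<partial>lborel)"
      unfolding T_def by (subst nn_integral_cmult) (auto simp: N_def power_one_over)
    also have "\<dots> = (\<integral>\<^sup>+x. ennreal (h x) \<partial>lborel)"
      unfolding T_def by (rule nn_integral_lborel_dilation[symmetric]) auto
    also have "\<dots> = (\<integral>\<^sup>+x\<in>D. ennreal ((cmod (f x))\<^sup>2) \<partial>lborel)"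
      by (intro nn_integral_cong) (simp add: h_def split: split_indicator)
    also have "\<dots> \<le> ennreal (1\<^sup>2)"
      unfolding nn_integral_L2_hol[OF f(1)] using f(2) L2_norm_on_nonneg[of D f]
      by (intro ennreal_leI power_mono)
    finally show ?thesis .
  qed
  ultimately have "g \<in> L2_hol D" "L2_norm_on D g \<le> 1"
    using L2_holI[of g D 1] \<open>open D\<close> by auto
  then have "(cmod (g z))\<^sup>2 \<le> bergman_K D z"
    using assms \<open>z \<in> D\<close> by (intro norm_square_le_bergman_K)
  then have "(cmod (f (z + Y)))\<^sup>2 \<le> N * bergman_K D z"
    using N by (simp add: g_def T_z norm_divide power_divide divide_le_eq mult.commute)
  then show ?thesis
    by (simp only: N_def)
qed

subsection \<open>The Bergman metric and distance\<close>

text \<open>The Cauchy estimate on the complex line through \<open>z\<close> in direction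
  \<open>X\<close>, with \<open>bergman_K_Harnack\<close> bounding \<open>f\<close> on the circle in
  terms of the kernel at \<open>z\<close> alone.\<close>

lemma norm_deriv_le_bergman_K:
  fixes D :: "(complex ^ 'n) set"
  assumes "open D" "convex D" "0 < r" "ball z r \<subseteq> D" and f: "f \<in> L2_hol D" "L2_norm_on D f \<le> 1"
  shows "cmod (frechet_derivative f (at z) X)
    \<le> 4 * sqrt (2 ^ DIM(complex ^ 'n)) * sqrt (bergman_K D z) * norm X / r"
proof -
  define M where "M = sqrt (2 ^ DIM(complex ^ 'n)) * sqrt (bergman_K D z)"
  have "z \<in> D"
    using assms(3,4) by auto
  have hol: "holomorphic_fun_on f D"
    using f by (simp add: L2_hol_def)
  then obtain f' where f': "(f has_derivative f') (at z)" "\<And>c X. f' (c *s X) = c * f' X"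
    using \<open>z \<in> D\<close> unfolding holomorphic_fun_on_def by meson
  have fd: "frechet_derivative f (at z) = f'"
    using frechet_derivative_at[OF f'(1)] by simp
  show ?thesis
  proof (cases "X = 0")
    case True
    then show ?thesis
      using f'(2)[of 0 0] by (simp add: fd)
  next
    case False
    \<comment> \<open>On the circle of radius \<open>\<rho>\<close> the displacement from
      \<open>z\<close> has norm \<open>r / 4\<close>, safely below the \<open>r / 2\<close> allowed
      for the kernel comparison. This is the origin of the factor 4.\<close>
    define \<rho> where "\<rho> = r / (4 * norm X)"
    have \<rho>: "0 < \<rho>" "\<rho> * norm X = r / 4"
      using False \<open>0 < r\<close> by (simp_all add: \<rho>_def)
    define g where "g \<zeta> = f (z + \<zeta> *s X)" for \<zeta>
    have small: "norm (\<zeta> *s X) < r / 2" if "cmod \<zeta> < 2 * \<rho>" for \<zeta>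
    proof -
      have "norm (\<zeta> *s X) < 2 * \<rho> * norm X"
        using that False by (simp add: norm_vector_scalar_mult)
      then show ?thesis
        using \<rho>(2) by simp
    qed
    have "g holomorphic_on ball 0 (2 * \<rho>)"
      unfolding g_def
    proof (rule holomorphic_fun_on_slice_holomorphic[OF hol])
      fix \<zeta> :: complex assume "\<zeta> \<in> ball 0 (2 * \<rho>)"
      then show "z + \<zeta> *s X \<in> D"
        using small[of \<zeta>] \<open>0 < r\<close> by (intro subsetD[OF assms(4)]) (simp add: dist_norm)
    qed simp
    then have g_hol: "g holomorphic_on cball 0 \<rho>"
      using \<rho>(1) by (elim holomorphic_on_subset) auto
    have "cmod ((deriv ^^ 1) g 0) \<le> fact 1 * M / \<rho> ^ 1"
    proof (rule Cauchy_inequality)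
      show "g holomorphic_on ball 0 \<rho>"
        using g_hol by (rule holomorphic_on_subset) auto
      show "continuous_on (cball 0 \<rho>) g"
        using g_hol by (rule holomorphic_on_imp_continuous_on)
      fix \<zeta> :: complex assume "cmod (0 - \<zeta>) = \<rho>"
      then have "norm (\<zeta> *s X) < r / 2"
        using small[of \<zeta>] \<rho>(1) by simp
      then have "(cmod (g \<zeta>))\<^sup>2 \<le> 2 ^ DIM(complex ^ 'n) * bergman_K D z"
        unfolding g_def using assms by (intro bergman_K_Harnack[of D z r]) auto
      then show "cmod (g \<zeta>) \<le> M"
        unfolding M_def by (metis real_le_rsqrt real_sqrt_mult)
    qed (use \<rho> in simp)
    moreover have "deriv g 0 = f' X"
      unfolding g_def using f' by (intro DERIV_imp_deriv holomorphic_fun_on_slice) auto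
    ultimately have "cmod (f' X) \<le> M / \<rho>"
      by simp
    also have "\<dots> = 4 * M * norm X / r"
      using False by (simp add: \<rho>_def)
    finally show ?thesis
      by (simp add: fd M_def mult.assoc)
  qed
qed

lemma bergman_K_nonneg:
  assumes "open D" "z \<in> D"
  shows "0 \<le> bergman_K D z"
proof -
  have hol: "holomorphic_fun_on (\<lambda>x. 0) D"
    unfolding holomorphic_fun_on_def by (intro ballI exI[of _ "\<lambda>_. 0"]) simp
  have "(\<lambda>x. 0) \<in> L2_hol D" "L2_norm_on D (\<lambda>x. 0) \<le> 1"
    using L2_holI[OF hol assms(1), of 1] by simp_all
  from norm_square_le_bergman_K[OF assms this] show ?thesis
    by simp
qed

text \<open>Ensures that the supremum in \<open>bergman_M\<close> is over a nonempty set. The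
  witness is a normalised coordinate function centred at \<open>z\<close>, square-integrable because
  \<open>D\<close> is bounded.\<close>

lemma ex_L2_hol_vanishing:
  fixes D :: "(complex ^ 'n) set"
  assumes "open D" "bounded D" "z \<in> D"
  shows "\<exists>f. f \<in> L2_hol D \<and> L2_norm_on D f = 1 \<and> f z = 0"
proof -
  fix i :: 'n
  define p where "p x = (x - z) $ i" for x
  have p': "(p has_derivative (\<lambda>h. h $ i)) (at x)" for x
    unfolding p_def
    by (rule bounded_linear.has_derivative[OF bounded_linear_vec_nth]) (auto intro!: derivative_eq_intros)
  have hol: "holomorphic_fun_on p D"
    unfolding holomorphic_fun_on_def using p' by (intro ballI exI[of _ "\<lambda>h. h $ i"]) simp
  obtain R where R: "\<And>x. x \<in> D \<Longrightarrow> norm (x - z) \<le> R"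
    using assms(2) by (metis bounded_any_center dist_norm norm_minus_commute)
  have "0 \<le> R"
    using R[OF assms(3)] by simp
  define V where "V = measure lborel D"
  have V: "emeasure lborel D = ennreal V"
    unfolding V_def using emeasure_bounded_finite[OF assms(2)]
    by (intro emeasure_eq_ennreal_measure) auto
  have "(\<integral>\<^sup>+x\<in>D. ennreal ((cmod (p x))\<^sup>2) \<partial>lborel) \<le> (\<integral>\<^sup>+x. ennreal (R\<^sup>2) * indicator D x \<partial>lborel)"
  proof (rule nn_integral_mono)
    fix x
    show "ennreal ((cmod (p x))\<^sup>2) * indicator D x \<le> ennreal (R\<^sup>2) * indicator D x"
    proof (cases "x \<in> D")
      case True
      then have "cmod (p x) \<le> R"
        unfolding p_def using Finite_Cartesian_Product.norm_nth_le[of "x - z" i] R[OF True] by linarith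
      then show ?thesis
        by (intro mult_right_mono ennreal_leI power_mono) auto
    qed simp
  qed
  also have "\<dots> = ennreal ((R * sqrt V)\<^sup>2)"
    using assms(1) by (simp add: nn_integral_cmult_indicator V power_mult_distrib V_def flip: ennreal_mult)
  finally have p: "p \<in> L2_hol D"
    using \<open>0 \<le> R\<close> by (intro L2_holI[OF hol assms(1), of "R * sqrt V"]) (simp_all add: V_def)
  define c where "c = L2_norm_on D p"
  have "c \<noteq> 0"
  proof
    assume "c = 0"
    then have zero: "(\<integral>\<^sup>+x\<in>D. ennreal ((cmod (p x))\<^sup>2) \<partial>lborel) = 0"
      by (simp add: nn_integral_L2_hol[OF p] c_def)
    obtain r where r: "0 < r" "ball z r \<subseteq> D"
      using assms openE by blast
    \<comment> \<open>At \<open>y\<close> the coordinate function equals \<open>r / 2\<close>, while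
      norm zero would force it to vanish there by the sub-mean value property.\<close>
    define y where "y = z + of_real (r / 2) *s axis i 1"
    have y: "dist z y = r / 2"
      using r by (simp add: y_def dist_norm norm_vector_scalar_mult norm_axis_1 del: of_real_divide)
    have sub: "ball y (r / 2) \<subseteq> D"
    proof
      fix x assume "x \<in> ball y (r / 2)"
      then have "x \<in> ball z r"
        using y dist_triangle[of z x y] by simp
      then show "x \<in> D"
        using r by auto
    qed
    have "y \<in> D"
      using sub r(1) by auto
    have "ennreal ((cmod (p y))\<^sup>2) * emeasure lborel (ball (0 :: complex ^ 'n) (r / 2)) \<le> 0"
      using holomorphic_fun_on_norm_square_le[OF hol assms(1) sub] zero by simp
    moreover have "emeasure lborel (ball (0 :: complex ^ 'n) (r / 2)) \<noteq> 0"
      using emeasure_lborel_ball_pos[of "r / 2" "0 :: complex ^ 'n"] r(1) by auto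
    ultimately have "p y = 0"
      by simp
    then show False
      using r(1) by (simp add: p_def y_def axis_def)
  qed
  then have c: "0 < c"
    using L2_norm_on_nonneg[of D p] by (simp add: c_def)
  define f where "f x = p x / of_real c" for x
  have "holomorphic_fun_on f D"
    unfolding holomorphic_fun_on_def
  proof (intro ballI exI conjI allI)
    show "(f has_derivative (\<lambda>h. h $ i / of_real c)) (at x)" for x
      unfolding f_def by (rule bounded_linear.has_derivative[OF bounded_linear_divide p'])
  qed simp
  moreover have "set_integrable lborel D (\<lambda>x. (cmod (f x))\<^sup>2)"
    using p c by (simp add: L2_hol_def f_def norm_divide power_divide)
  moreover have "L2_norm_on D f = 1"
    using c by (simp add: L2_norm_on_def f_def norm_divide power_divide real_sqrt_divide c_def)
  moreover have "f z = 0"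
    by (simp add: f_def p_def)
  ultimately show ?thesis
    by (auto simp: L2_hol_def)
qed

lemma bergman_metric_le:
  fixes D :: "(complex ^ 'n) set"
  assumes "open D" "convex D" "bounded D" "0 < r" "ball z r \<subseteq> D"
  shows "bergman_metric D z X \<le> 4 * sqrt (2 ^ DIM(complex ^ 'n)) * norm X / r"
proof -
  define C where "C = 4 * sqrt (2 ^ DIM(complex ^ 'n)) * norm X / r"
  have "0 \<le> C"
    using assms(4) by (simp add: C_def)
  have z: "z \<in> D"
    using assms(4,5) by auto
  have "bergman_M D z X \<le> C * sqrt (bergman_K D z)"
    unfolding bergman_M_def
  proof (rule cSup_least)
    show "{cmod (frechet_derivative f (at z) X) |f. f \<in> L2_hol D \<and> L2_norm_on D f = 1 \<and> f z = 0} \<noteq> {}"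
      using ex_L2_hol_vanishing[OF assms(1,3) z] by auto
    fix y assume "y \<in> {cmod (frechet_derivative f (at z) X) |f. f \<in> L2_hol D \<and> L2_norm_on D f = 1 \<and> f z = 0}"
    then obtain f where f: "y = cmod (frechet_derivative f (at z) X)" "f \<in> L2_hol D" "L2_norm_on D f = 1"
      by blast
    have "y \<le> 4 * sqrt (2 ^ DIM(complex ^ 'n)) * sqrt (bergman_K D z) * norm X / r"
      unfolding f(1) using f(2,3) assms by (intro norm_deriv_le_bergman_K) auto
    also have "\<dots> = C * sqrt (bergman_K D z)"
      by (simp add: C_def)
    finally show "y \<le> C * sqrt (bergman_K D z)" .
  qed
  \<comment> \<open>If the kernel vanishes at \<open>z\<close>, division by zero makes the metric 0,
    which \<open>C\<close> still bounds.\<close>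
  then have "bergman_metric D z X \<le> C"
    unfolding bergman_metric_def using \<open>0 \<le> C\<close> bergman_K_nonneg[OF assms(1) z]
    by (cases "bergman_K D z = 0") (auto simp: pos_divide_le_eq)
  then show ?thesis
    by (simp add: C_def)
qed

section \<open>Segments as competitors for the Bergman distance\<close>

lemma curve_deriv_segment:
  assumes "t \<in> {0..1}"
  shows "curve_deriv (\<lambda>t. z + t *\<^sub>R v) t = v"
  by (rule vector_derivative_within_cbox[of 0 1, unfolded cbox_interval])
    (use assms in \<open>auto intro!: derivative_eq_intros\<close>)

lemma segment_in_smooth_curves:
  fixes D :: "(complex ^ 'n) set"
  assumes "convex D" "z \<in> D" "w \<in> D"
  shows "(\<lambda>t. z + t *\<^sub>R (w - z)) \<in> smooth_curves D z w"
proof -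
  define \<gamma> where "\<gamma> t = z + t *\<^sub>R (w - z)" for t
  \<comment> \<open>All derivatives from the first on are constant on the unit interval. Nothing is
    claimed outside it, so later derivatives are taken within the interval.\<close>
  have const: "\<exists>v. \<forall>t\<in>{0..1}. (curve_deriv ^^ Suc k) \<gamma> t = v" for k
  proof (induction k)
    case 0
    show ?case
      unfolding \<gamma>_def by (intro exI[of _ "w - z"]) (simp add: curve_deriv_segment)
  next
    case (Suc k)
    then obtain v where v: "\<And>t. t \<in> {0..1} \<Longrightarrow> (curve_deriv ^^ Suc k) \<gamma> t = v"
      by blast
    have "(curve_deriv ^^ Suc (Suc k)) \<gamma> t = 0" if t: "t \<in> {0..1}" for t
    proof -
      have "((curve_deriv ^^ Suc k) \<gamma> has_vector_derivative 0) (at t within {0..1})"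
        using t v by (intro has_vector_derivative_transform[OF t _ has_vector_derivative_const[of v]]) auto
      then show ?thesis
        using t vector_derivative_within_cbox[of 0 1 t] by (simp add: cbox_interval)
    qed
    then show ?case
      by blast
  qed
  have "(curve_deriv ^^ k) \<gamma> differentiable_on {0..1}" for k
  proof (cases k)
    case 0
    have "(\<gamma> has_vector_derivative w - z) (at t within {0..1})" for t
      unfolding \<gamma>_def by (auto intro!: derivative_eq_intros)
    with 0 show ?thesis
      by (auto simp: differentiable_on_def intro: differentiableI_vector)
  next
    case (Suc k')
    then obtain v where v: "\<And>t. t \<in> {0..1} \<Longrightarrow> (curve_deriv ^^ k) \<gamma> t = v"
      using const by blast
    have "((curve_deriv ^^ k) \<gamma> has_vector_derivative 0) (at t within {0..1})" if "t \<in> {0..1}" for t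
      using v by (intro has_vector_derivative_transform[OF that _ has_vector_derivative_const[of v]]) auto
    then show ?thesis
      unfolding differentiable_on_def by (blast intro: differentiableI_vector)
  qed
  moreover have "\<gamma> t \<in> D" if "t \<in> {0..1}" for t
  proof -
    have "\<gamma> t = (1 - t) *\<^sub>R z + t *\<^sub>R w"
      by (simp add: \<gamma>_def algebra_simps)
    then show ?thesis
      using that convexD[OF assms, of "1 - t" t] by auto
  qed
  ultimately show ?thesis
    unfolding smooth_curves_def \<gamma>_def by auto
qed

text \<open>The segment is the competitor, and the interpolated radius bounds its Bergman speed. The
  radii are free instead of being boundary distances, so that they can later be chosen
  distinct.\<close>

lemma bergman_dist_le:
  fixes D :: "(complex ^ 'n) set"
  assumes D: "open D" "convex D" "bounded D" and r: "0 < r" "ball z r \<subseteq> D" and s: "0 < s" "ball w s \<subseteq> D"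
    and "r \<noteq> s"
  shows "bergman_dist D z w
    \<le> ereal (4 * sqrt (2 ^ DIM(complex ^ 'n)) * norm (z - w) * (ln (r / s) / (r - s)))"
proof -
  define C where "C = 4 * sqrt (2 ^ DIM(complex ^ 'n)) * norm (z - w)"
  have C: "0 \<le> C"
    by (simp add: C_def)
  define \<gamma> where "\<gamma> t = z + t *\<^sub>R (w - z)" for t
  define \<rho> where "\<rho> t = (1 - t) * r + t * s" for t
  have \<rho>: "0 < \<rho> t" if "t \<in> {0..1}" for t
    unfolding \<rho>_def using interpolate_pos that r s by simp
  have "\<gamma> \<in> smooth_curves D z w"
    unfolding \<gamma>_def using r s by (intro segment_in_smooth_curves D) auto
  then have "bergman_dist D z w
      \<le> enn2ereal (\<integral>\<^sup>+t\<in>{0..1}. ennreal (bergman_metric D (\<gamma> t) (curve_deriv \<gamma> t)) \<partial>lborel)"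
    unfolding bergman_dist_def by (rule INF_lower)
  also have "\<dots> \<le> enn2ereal (\<integral>\<^sup>+t. ennreal (C * (1 / \<rho> t)) * indicator {0..1} t \<partial>lborel)"
  proof (rule less_eq_ennreal.rep_eq[THEN iffD1], rule nn_integral_mono)
    fix t :: real
    show "ennreal (bergman_metric D (\<gamma> t) (curve_deriv \<gamma> t)) * indicator {0..1} t
        \<le> ennreal (C * (1 / \<rho> t)) * indicator {0..1} t"
    proof (cases "t \<in> {0..1}")
      case True
      have "\<gamma> t = (1 - t) *\<^sub>R z + t *\<^sub>R w"
        by (simp add: \<gamma>_def algebra_simps)
      then have "ball (\<gamma> t) (\<rho> t) \<subseteq> D"
        unfolding \<rho>_def using convex_ball_interpolate[OF D(2) r(2) s(2) r(1) s(1), of t] True by simp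
      moreover have "curve_deriv \<gamma> t = w - z"
        unfolding \<gamma>_def by (rule curve_deriv_segment[OF True])
      ultimately have "bergman_metric D (\<gamma> t) (curve_deriv \<gamma> t) \<le> C * (1 / \<rho> t)"
        using bergman_metric_le[OF D \<rho>[OF True], of "\<gamma> t" "w - z"]
        by (simp add: C_def norm_minus_commute)
      then show ?thesis
        by (intro mult_right_mono ennreal_leI) auto
    qed simp
  qed
  also have "(\<integral>\<^sup>+t. ennreal (C * (1 / \<rho> t)) * indicator {0..1} t \<partial>lborel)
      = ennreal (C * (ln (r / s) / (r - s)))"
  proof (rule nn_integral_has_integral_lebesgue')
    define F where "F t = C * (- ln ((1 - t) * r + t * s) / (r - s))" for t
    have "(F has_real_derivative C * (1 / \<rho> t)) (at t)" if "t \<in> {0..1}" for t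
      unfolding F_def \<rho>_def by (rule DERIV_cmult, rule DERIV_ln_interpolate(1)[OF r(1) s(1) that \<open>r \<noteq> s\<close>])
    then have "((\<lambda>t. C * (1 / \<rho> t)) has_integral F 1 - F 0) {0..1}"
      by (intro fundamental_theorem_of_calculus)
        (auto simp flip: has_real_derivative_iff_has_vector_derivative intro: has_field_derivative_at_within)
    moreover have "F 1 - F 0 = C * (ln (r / s) / (r - s))"
      using r s by (simp add: F_def ln_div diff_divide_distrib right_diff_distrib)
    ultimately show "((\<lambda>t. C * (1 / \<rho> t)) has_integral C * (ln (r / s) / (r - s))) {0..1}"
      by simp
    show "0 \<le> C * (1 / \<rho> t)" if "t \<in> {0..1}" for t
      using C \<rho>[OF that] by simp
  qed
  \<comment> \<open>Since \<open>ennreal\<close> truncates negative reals to 0, the sign is checked: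
    \<open>ln (r / s)\<close> and \<open>r - s\<close> have the same sign.\<close>
  also have "enn2ereal (ennreal (C * (ln (r / s) / (r - s)))) = ereal (C * (ln (r / s) / (r - s)))"
  proof (rule enn2ereal_ennreal)
    have "0 \<le> ln (r / s) / (r - s)"
      using r s \<open>r \<noteq> s\<close> by (cases "s < r") (auto simp: zero_le_divide_iff ln_ge_zero)
    then show "0 \<le> C * (ln (r / s) / (r - s))"
      using C by (intro mult_nonneg_nonneg)
  qed
  finally show ?thesis
    by (simp only: C_def)
qed

lemma bergman_dist_log_bound:
  fixes D :: "(complex ^ 'n) set"
  assumes D: "open D" "convex D" "bounded D" "frontier D \<noteq> {}" and K: "compact K" "K \<subseteq> D"
  shows "\<exists>c>0. \<exists>C>0. \<forall>z\<in>K. \<forall>w\<in>D. bergman_dist D z w \<le> ereal (- c * ln (bdry_dist D w) + C)"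
proof (cases "K = {}")
  case True
  then show ?thesis
    by (auto intro: exI[of _ 1])
next
  case False
  have "continuous_on K (bdry_dist D)"
    unfolding bdry_dist_def by (intro continuous_intros)
  then obtain x where x: "x \<in> K" "\<And>z. z \<in> K \<Longrightarrow> bdry_dist D x \<le> bdry_dist D z"
    using continuous_attains_inf[OF K(1) False] by blast
  define a where "a = bdry_dist D x"
  have a: "0 < a"
    unfolding a_def using D K x by (intro bdry_dist_pos) auto
  \<comment> \<open>A single diameter bound controls both \<open>norm (z - w)\<close> and all
    boundary distances, as frontier points lie in the closure.\<close>
  obtain B where B: "\<And>x y. x \<in> closure D \<Longrightarrow> y \<in> closure D \<Longrightarrow> dist x y \<le> B"
    using diameter_bounded_bound[OF bounded_closure[OF D(3)]] by blast
  obtain y where y: "y \<in> frontier D"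
    using D(4) by auto
  have le_B: "bdry_dist D w \<le> B" if "w \<in> D" for w
    unfolding bdry_dist_def
    by (rule infdist_le2[OF y B]) (use that y closure_subset frontier_def in auto)
  have "a \<le> B"
    unfolding a_def using x K by (intro le_B) auto
  with a have "0 < B"
    by linarith
  define C where "C = 4 * sqrt (2 ^ DIM(complex ^ 'n))"
  define c where "c = C * B * (2 / a)"
  have "0 < C"
    by (simp add: C_def)
  then have "0 < c"
    using a \<open>0 < B\<close> by (simp add: c_def)
  \<comment> \<open>The summand 1 and the absolute value make the additive constant positive
    whatever the sign of \<open>ln (2 * B)\<close>.\<close>
  have "bergman_dist D z w \<le> ereal (- c * ln (bdry_dist D w) + c * (1 + \<bar>ln (2 * B)\<bar>))"
    if zw: "z \<in> K" "w \<in> D" for z w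
  proof -
    define d where "d = bdry_dist D w"
    have d: "0 < d" "d \<le> B"
      using bdry_dist_pos[OF D(1,4) zw(2)] le_B[OF zw(2)] by (simp_all add: d_def)
    \<comment> \<open>Proportionality to \<open>d\<close> gives
      \<open>ln (a / s) = ln (2 * B) - ln d\<close>. The factor keeps \<open>s\<close> below
      \<open>d\<close>, so the ball stays in \<open>D\<close>, and below \<open>a / 2\<close>, so
      \<open>a - s\<close> is at least \<open>a / 2\<close>.\<close>
    define s where "s = a * (d / (2 * B))"
    have s: "0 < s" "s \<le> d" "s \<le> a / 2"
    proof -
      show "0 < s"
        using a d \<open>0 < B\<close> by (simp add: s_def)
      have "a / (2 * B) \<le> 1"
        using \<open>a \<le> B\<close> \<open>0 < B\<close> by simp
      then have "a / (2 * B) * d \<le> 1 * d"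
        using d by (intro mult_right_mono) auto
      then show "s \<le> d"
        by (simp add: s_def)
      have "a * (d / (2 * B)) \<le> a * (1 / 2)"
        using a d \<open>0 < B\<close> by (intro mult_left_mono) (auto simp: field_simps)
      then show "s \<le> a / 2"
        by (simp add: s_def)
    qed
    have "ball z a \<subseteq> D"
      using ball_bdry_dist_subset[of z D] x(2)[OF zw(1)] zw K by (force simp: a_def)
    moreover have "ball w s \<subseteq> D"
      using ball_bdry_dist_subset[OF zw(2)] s(2) by (force simp: d_def)
    ultimately have "bergman_dist D z w \<le> ereal (C * norm (z - w) * (ln (a / s) / (a - s)))"
      unfolding C_def using a s by (intro bergman_dist_le D) auto
    also have "C * norm (z - w) * (ln (a / s) / (a - s)) \<le> C * B * (2 / a * ln (a / s))"
    proof (intro mult_mono)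
      show "norm (z - w) \<le> B"
        using B[of z w] zw K closure_subset[of D] by (auto simp: dist_norm)
      have "0 \<le> ln (a / s)"
        using s a by (intro ln_ge_zero) auto
      moreover have "1 / (a - s) \<le> 2 / a"
        using s a by (simp add: field_simps)
      ultimately have "ln (a / s) * (1 / (a - s)) \<le> ln (a / s) * (2 / a)"
        by (intro mult_left_mono)
      then show "ln (a / s) / (a - s) \<le> 2 / a * ln (a / s)"
        by (simp add: mult.commute)
      show "0 \<le> ln (a / s) / (a - s)"
        using \<open>0 \<le> ln (a / s)\<close> s a by simp
    qed (use \<open>0 < C\<close> \<open>0 < B\<close> in auto)
    also have "\<dots> = c * (ln (2 * B) - ln d)"
    proof -
      have "a / s = 2 * B / d"
        using a d \<open>0 < B\<close> by (simp add: s_def)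
      then show ?thesis
        using d \<open>0 < B\<close> by (simp add: c_def ln_div)
    qed
    also have "\<dots> \<le> - c * ln d + c * (1 + \<bar>ln (2 * B)\<bar>)"
    proof -
      have "c * ln (2 * B) \<le> c * (1 + \<bar>ln (2 * B)\<bar>)"
        using \<open>0 < c\<close> by (intro mult_left_mono) auto
      then show ?thesis
        by (simp add: right_diff_distrib)
    qed
    finally show ?thesis
      by (simp add: d_def)
  qed
  moreover have "0 < c * (1 + \<bar>ln (2 * B)\<bar>)"
    using \<open>0 < c\<close> by (simp add: add_pos_nonneg)
  ultimately show ?thesis
    using \<open>0 < c\<close> by blast
qed

theorem proposition1:
  fixes D :: "(complex ^ 'n) set"
  assumes "open D" and "connected D" and "D \<noteq> {}" and "D \<noteq> UNIV" and "convex D"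
  shows "(\<forall>z\<in>D. \<forall>w\<in>D.
            (bdry_dist D z \<noteq> bdry_dist D w \<longrightarrow>
               lempert D z w \<le>
                 ereal (norm (z - w) / (bdry_dist D z - bdry_dist D w)
                          * ln (bdry_dist D z / bdry_dist D w)) \<and>
               norm (z - w) / (bdry_dist D z - bdry_dist D w)
                   * ln (bdry_dist D z / bdry_dist D w)
                 \<le> norm (z - w) / min (bdry_dist D z) (bdry_dist D w)) \<and>
            (bdry_dist D z = bdry_dist D w \<longrightarrow>
               lempert D z w \<le> ereal (norm (z - w) / bdry_dist D w)))
       \<and> (bounded D \<longrightarrow>
            (\<forall>K. compact K \<and> K \<subseteq> D \<longrightarrow>
               (\<exists>c>0. \<exists>C>0. \<forall>z\<in>K. \<forall>w\<in>D.
                  bergman_dist D z w \<le> ereal (- c * ln (bdry_dist D w) + C))))"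
proof (intro conjI ballI impI allI)
  have fr: "frontier D \<noteq> {}"
    using assms by (intro frontier_nonempty)
  fix z w assume zw: "z \<in> D" "w \<in> D"
  define r s where "r = bdry_dist D z" and "s = bdry_dist D w"
  have r: "0 < r" "ball z r \<subseteq> D" and s: "0 < s" "ball w s \<subseteq> D"
    unfolding r_def s_def using zw fr assms(1) by (simp_all add: bdry_dist_pos ball_bdry_dist_subset)
  note lempert_le = lempert_le_radius_integral[OF assms(1,5) r(2) s(2) r(1) s(1)]
  {
    assume "bdry_dist D z \<noteq> bdry_dist D w"
    then have "r \<noteq> s"
      by (simp add: r_def s_def)
    \<comment> \<open>The endpoint values of the antiderivative are left unsimplified to match the
      instantiated rule; the radius is \<open>s\<close> at 1 and \<open>r\<close> at 0.\<close>
    have "lempert D z w \<le> ereal (norm (z - w) *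
        (- ln ((1 - 1) * r + 1 * s) / (r - s) - - ln ((1 - 0) * r + 0 * s) / (r - s)))"
      by (rule lempert_le[OF DERIV_ln_interpolate(1)[OF r(1) s(1) _ \<open>r \<noteq> s\<close>]])
    also have "norm (z - w) *
        (- ln ((1 - 1) * r + 1 * s) / (r - s) - - ln ((1 - 0) * r + 0 * s) / (r - s))
        = norm (z - w) / (r - s) * ln (r / s)"
      using r s by (simp add: ln_div diff_divide_distrib right_diff_distrib)
    finally show "lempert D z w \<le> ereal (norm (z - w) / (bdry_dist D z - bdry_dist D w)
        * ln (bdry_dist D z / bdry_dist D w))"
      by (simp add: r_def s_def)
    have "norm (z - w) * (ln (r / s) / (r - s)) \<le> norm (z - w) * (1 / min r s)"
      using r s \<open>r \<noteq> s\<close> by (intro mult_left_mono ln_quotient_le_inverse_min) auto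
    then show "norm (z - w) / (bdry_dist D z - bdry_dist D w) * ln (bdry_dist D z / bdry_dist D w)
        \<le> norm (z - w) / min (bdry_dist D z) (bdry_dist D w)"
      by (simp add: r_def s_def)
  }
  {
    assume "bdry_dist D z = bdry_dist D w"
    then have "r = s"
      by (simp add: r_def s_def)
    show "lempert D z w \<le> ereal (norm (z - w) / bdry_dist D w)"
      using lempert_le[OF DERIV_ln_interpolate(2)[OF r(1) s(1) _ \<open>r = s\<close>]] by (simp add: s_def)
  }
next
  fix K assume "bounded D" "compact K \<and> K \<subseteq> D"
  then show "\<exists>c>0. \<exists>C>0. \<forall>z\<in>K. \<forall>w\<in>D. bergman_dist D z w \<le> ereal (- c * ln (bdry_dist D w) + C)"
    using assms by (intro bergman_dist_log_bound frontier_nonempty) auto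
qed

end
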